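(* Let $f\colon \mathbb{N}\rightarrow \mathbb{N}$ be a non-decreasing submultiplicative function such that $\lim_{n\rightarrow \infty} f(n)=\infty$. Then, over an arbitrary field $\Bbbk$, there exists a finitely generated simple associative $\Bbbk$-algebra $A$ such that $nf(n)\preceq \gamma_A(n) \preceq n^2 f(n)$.
   Context: A function $f\colon\mathbb{N}\to\mathbb{N}$ is submultiplicative if $f(n+m)\leq f(n)f(m)$ for all $n,m\in\mathbb{N}$. Let $\Bbbk$ be a field and $A$ a finitely generated associative $\Bbbk$-algebra. Its growth function is $\gamma_A(n)=\dim_{\Bbbk}V^{\leq n}$, where $V$ is a finite-dimensional subspace of $A$ that generates $A$ as an algebra, and $V^{\leq n}$ is the space spanned by all products of at most $n$ elements of $V$. Up to the asymptotic equivalence ($f\preceq g$ and $g\preceq f$) this does not depend on the choice of $V$. For non-decreasing functions $f,g\colon\mathbb{N}\to\mathbb{N}$, write $f\preceq g$ (also written $f(n)\preceq g(n)$) if there are constants $C,D>0$ such that $f(n)\leq C g(Dn)$ for all $n\geq 1$ (as $g$ is non-decreasing, $D$ may be taken to be a positive integer). Here $nf(n)$ and $n^2f(n)$ denote the functions $n\mapsto n\cdot f(n)$ and $n\mapsto n^2\cdot f(n)$. *)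

theory Defs
  imports
    Complex_Main
    "HOL-Algebra.Module"
    "HOL-Algebra.Ideal"
    "HOL-Algebra.Subrings"
    "HOL-Algebra.Algebraic_Closure_Type"
begin

section \<open>Functions on the natural numbers\<close>

definition submultiplicative :: "(nat \<Rightarrow> nat) \<Rightarrow> bool" where
  "submultiplicative f \<longleftrightarrow> (\<forall>n m. f (n + m) \<le> f n * f m)"

definition growth_le :: "(nat \<Rightarrow> nat) \<Rightarrow> (nat \<Rightarrow> nat) \<Rightarrow> bool" where
  "growth_le f g \<longleftrightarrow>
     (\<exists>(C::real) > 0. \<exists>(D::nat) > 0. \<forall>n\<ge>1. real (f n) \<le> C * real (g (D * n)))"


section \<open>Associative algebras\<close>

text \<open>The library locale \<^locale>\<open>algebra\<close> demands a commutative multiplication;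
  this is the same notion for associative unital rings.\<close>

locale assoc_algebra = module + ring M +
  assumes smult_mult_left:
      "\<lbrakk>a \<in> carrier R; x \<in> carrier M; y \<in> carrier M\<rbrakk> \<Longrightarrow>
       (a \<odot>\<^bsub>M\<^esub> x) \<otimes>\<^bsub>M\<^esub> y = a \<odot>\<^bsub>M\<^esub> (x \<otimes>\<^bsub>M\<^esub> y)"
    and smult_mult_right:
      "\<lbrakk>a \<in> carrier R; x \<in> carrier M; y \<in> carrier M\<rbrakk> \<Longrightarrow>
       x \<otimes>\<^bsub>M\<^esub> (a \<odot>\<^bsub>M\<^esub> y) = a \<odot>\<^bsub>M\<^esub> (x \<otimes>\<^bsub>M\<^esub> y)"

text \<open>As \<open>A\<close> is unital, its two-sided ring ideals are closed under scalar multiplication,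
  so they are exactly its two-sided algebra ideals.\<close>

definition simple_algebra :: "('k, 'a, 'm) module_scheme \<Rightarrow> bool" where
  "simple_algebra A \<longleftrightarrow>
     carrier A \<noteq> {\<zero>\<^bsub>A\<^esub>} \<and> (\<forall>I. ideal I A \<longrightarrow> I = {\<zero>\<^bsub>A\<^esub>} \<or> I = carrier A)"


section \<open>Linear span and dimension\<close>

text \<open>The notions of \<^theory>\<open>HOL.Vector_Spaces\<close>, for modules with an explicit carrier.\<close>

definition lin_span ::
    "('k, 'r) ring_scheme \<Rightarrow> ('k, 'a, 'm) module_scheme \<Rightarrow> 'a set \<Rightarrow> 'a set" where
  "lin_span K A S = \<Inter>{N. submodule N K A \<and> S \<subseteq> N}"

definition lin_independent ::
    "('k, 'r) ring_scheme \<Rightarrow> ('k, 'a, 'm) module_scheme \<Rightarrow> 'a set \<Rightarrow> bool" where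
  "lin_independent K A B \<longleftrightarrow> (\<forall>b\<in>B. b \<notin> lin_span K A (B - {b}))"

definition lin_dim ::
    "('k, 'r) ring_scheme \<Rightarrow> ('k, 'a, 'm) module_scheme \<Rightarrow> 'a set \<Rightarrow> nat" where
  "lin_dim K A W =
     card (SOME B. B \<subseteq> W \<and> lin_independent K A B \<and> lin_span K A B = W)"


section \<open>Generation and growth\<close>

definition generating_subspace ::
    "('k, 'r) ring_scheme \<Rightarrow> ('k, 'a, 'm) module_scheme \<Rightarrow> 'a set \<Rightarrow> bool" where
  "generating_subspace K A V \<longleftrightarrow>
     submodule V K A \<and>
     (\<exists>S. finite S \<and> S \<subseteq> V \<and> lin_span K A S = V) \<and>
     (\<forall>B. subring B A \<and> submodule B K A \<and> V \<subseteq> B \<longrightarrow> B = carrier A)"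

definition finitely_generated_algebra ::
    "('k, 'r) ring_scheme \<Rightarrow> ('k, 'a, 'm) module_scheme \<Rightarrow> bool" where
  "finitely_generated_algebra K A \<longleftrightarrow> (\<exists>V. generating_subspace K A V)"

text \<open>The empty product \<open>\<one>\<close> counts as a product of at most \<open>n\<close> elements.\<close>

definition power_le ::
    "('k, 'r) ring_scheme \<Rightarrow> ('k, 'a, 'm) module_scheme \<Rightarrow> 'a set \<Rightarrow> nat \<Rightarrow> 'a set" where
  "power_le K A V n =
     lin_span K A {foldr (\<otimes>\<^bsub>A\<^esub>) xs \<one>\<^bsub>A\<^esub> | xs. set xs \<subseteq> V \<and> length xs \<le> n}"

definition growth_function ::
    "('k, 'r) ring_scheme \<Rightarrow> ('k, 'a, 'm) module_scheme \<Rightarrow> 'a set \<Rightarrow> nat \<Rightarrow> nat" where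
  "growth_function K A V n = lin_dim K A (power_le K A V n)"

end

theory Submission
  imports Defs "HOL-Library.Sublist" "HOL-Library.Function_Algebras" "HOL-Library.Nat_Bijection"
begin

text \<open>
  The algebra is attached to a bi-infinite word \<open>w\<close> over a finite alphabet.  Its elements are the
  band matrices, with rows and columns indexed by the integers, whose entry at \<open>(i, i + d)\<close> depends
  only on \<open>d\<close> and on the letters of \<open>w\<close> in a window of bounded radius around \<open>i\<close>.  This is a faithful
  copy of the crossed product of the locally constant functions on the subshift of \<open>w\<close> by the
  shift.  Two facts make it useful.

  Growth.  If the generators have window radius and bandwidth at most \<open>m\<close>, then products of \<open>n\<close> of
  them have both at most \<open>m n\<close>, and such a matrix is determined by one scalar for each of the
  \<open>2 m n + 1\<close> diagonals and each factor of \<open>w\<close> of length \<open>2 m n + 1\<close>.  Conversely, for each factor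
  \<open>u\<close> of length \<open>n\<close> and each \<open>s < n\<close>, the indicator of the occurrences of \<open>u\<close>, placed on the diagonal
  \<open>n - s\<close>, is a product of \<open>n + s\<close> fixed elements, and these \<open>n p(n)\<close> indicators are linearly
  independent, where \<open>p\<close> is the factor complexity of \<open>w\<close>.  So the growth is that of \<open>n p(n)\<close>.

  Simplicity.  Let \<open>w\<close> be uniformly recurrent and not periodic, and let \<open>b\<close> lie in an ideal with a
  nonzero diagonal entry at \<open>i\<close>.  A long enough window of \<open>w\<close> around \<open>i\<close> does not return at a distance
  within the bandwidth of \<open>b\<close>; cutting \<open>b\<close> down on both sides to the occurrences of this window
  leaves a nonzero multiple of their indicator.  By uniform recurrence finitely many translates of
  these occurrences cover the integers, so the ideal contains the identity.

  It remains to find a uniformly recurrent \<open>w\<close> whose complexity lies between \<open>f(n)\<close> and \<open>n f(n)\<close>, up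
  to constants.  Build finite sets \<open>W k\<close> of words of a common length of order \<open>2 ^ k\<close> by
  \<open>W (k + 1) = C k \<cdot> W k\<close> with \<open>C k \<subseteq> W k\<close>.  Submultiplicativity, in the form
  \<open>f (2 ^ (k + 1)) \<le> (f (2 ^ k))\<^sup>2\<close>, leaves room to choose the size of \<open>C k\<close> such that \<open>W k\<close> always has
  between \<open>f (2 ^ k)\<close> and \<open>2 f (2 ^ k)\<close> elements.  A short word lies in a word of \<open>C k\<close> next to a word
  of \<open>W k\<close>, in one of the two orders, and this gives the upper bound for the complexity.  To enforce
  recurrence, a pad that runs through all of some earlier \<open>W j\<close> is inserted between the two factors
  of \<open>W (k + 1)\<close>, but only once its length is at most \<open>k\<close>, so that the lengths stay of order
  \<open>2 ^ k\<close>.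
\<close>

section \<open>Windows of bi-infinite words\<close>

definition window :: "(int \<Rightarrow> 'a) \<Rightarrow> int \<Rightarrow> nat \<Rightarrow> 'a list" where
  "window w i n = map (\<lambda>t. w (i + int t)) [0..<n]"

lemma length_window [simp]: "length (window w i n) = n"
  by (simp add: window_def)

lemma nth_window [simp]: "t < n \<Longrightarrow> window w i n ! t = w (i + int t)"
  by (simp add: window_def)

lemma window_0 [simp]: "window w i 0 = []"
  by (simp add: window_def)

lemma finite_letters:
  assumes "finite (range (\<lambda>i. window w i 1))"
  shows "finite (range w)"
proof -
  have "range w = hd ` range (\<lambda>i. window w i 1)" by (simp add: image_image window_def)
  then show ?thesis using assms by simp
qed

lemma window_eq_iff: "window w i n = window w j n \<longleftrightarrow> (\<forall>t<n. w (i + int t) = w (j + int t))"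
  by (auto simp: list_eq_iff_nth_eq)

lemma window_add: "window w i (m + n) = window w i m @ window w (i + int m) n"
  by (auto simp: list_eq_iff_nth_eq nth_append)

lemma window_sublist:
  assumes "j \<le> i" "i + int n \<le> j + int m"
  shows "sublist (window w i n) (window w j m)"
proof -
  define a where "a = nat (i - j)"
  have a: "int a = i - j" using assms a_def by simp
  define b where "b = m - a - n"
  have m: "m = a + (n + b)" using assms a b_def by linarith
  have "window w j m = window w j a @ window w (j + int a) n @ window w (j + int a + int n) b"
    unfolding m window_add ..
  then show ?thesis using a by auto
qed

lemma sublist_windowE:
  assumes "sublist u (window w i n)"
  obtains k where "u = window w (i + int k) (length u)" "k + length u \<le> n"
proof -
  from assms obtain p q where pq: "window w i n = p @ u @ q" by (auto simp: sublist_def)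
  then have n: "n = length p + (length u + length q)"
    by (metis length_append length_window)
  have "window w i n = window w i (length p) @ window w (i + int (length p)) (length u)
     @ window w (i + int (length p) + int (length u)) (length q)"
    unfolding n window_add by simp
  then have "u = window w (i + int (length p)) (length u)" using pq by (simp add: append_eq_append_conv)
  then show ?thesis using that n by simp
qed

text \<open>Extending a word by one letter on either side keeps its centre in place, so iterating the
  extension from the empty word defines a letter at every integer.\<close>

lemma bi_infinite_word:
  fixes L :: "'a list set"
  assumes sub: "\<And>u v. v \<in> L \<Longrightarrow> sublist u v \<Longrightarrow> u \<in> L"
    and ne: "L \<noteq> {}"
    and ext: "\<And>u. u \<in> L \<Longrightarrow> \<exists>x y. x # u @ [y] \<in> L"
  obtains w where "\<And>i n. window w i n \<in> L"
proof -
  have nil: "[] \<in> L" using ne sub by blast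
  have "\<exists>U. \<forall>n. (U n \<in> L \<and> (n = 0 \<longrightarrow> U n = [])) \<and> (\<exists>x y. U (Suc n) = x # U n @ [y])"
  proof (rule dependent_nat_choice)
    show "\<exists>u. u \<in> L \<and> (0 = (0::nat) \<longrightarrow> u = [])" using nil by blast
    show "\<exists>v. (v \<in> L \<and> (Suc n = 0 \<longrightarrow> v = [])) \<and> (\<exists>x y. v = x # u @ [y])"
      if "u \<in> L \<and> (n = 0 \<longrightarrow> u = [])" for u n using ext that by blast
  qed
  then obtain U where U: "\<And>n. U n \<in> L" "U 0 = []" "\<And>n. \<exists>x y. U (Suc n) = x # U n @ [y]"
    by metis
  then obtain A B where AB: "\<And>n. U (Suc n) = A n # U n @ [B n]" by metis
  define w where "w i = (if i \<ge> 0 then B (nat i) else A (nat (- i - 1)))" for i :: int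
  have U_window: "U n = window w (- int n) (2 * n)" for n
  proof (induction n)
    case 0 then show ?case by (simp add: U)
  next
    case (Suc n)
    have e: "2 * Suc n = 1 + (2 * n + 1)" by simp
    have "window w (- int (Suc n)) (2 * Suc n)
       = window w (- int (Suc n)) 1 @ window w (- int n) (2*n) @ window w (int n) 1"
      unfolding e window_add by simp
    also have "\<dots> = A n # U n @ [B n]" by (simp add: Suc window_def w_def nat_diff_distrib)
    finally show ?case using AB by simp
  qed
  show ?thesis
  proof (rule that)
    fix i n
    define m where "m = nat (\<bar>i\<bar> + int n)"
    have "sublist (window w i n) (U m)"
      unfolding U_window by (rule window_sublist) (auto simp: m_def)
    then show "window w i n \<in> L" using U sub by blast
  qed
qed

section \<open>Factors of concatenations\<close>

text \<open>A word that is no longer than the middle part cannot stick out of it on both sides.\<close>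

lemma sublist_overlap:
  assumes "sublist v (a @ m @ c)" "length v \<le> length m"
  shows "sublist v (a @ m) \<or> sublist v (m @ c)"
proof -
  from assms obtain p q where pq: "a @ m @ c = p @ v @ q" by (auto simp: sublist_def)
  show ?thesis
  proof (cases "length a \<le> length p")
    case True
    have "prefix a (a @ m @ c)" "prefix p (a @ m @ c)" by (simp, simp add: pq)
    then obtain p' where "p = a @ p'" using True by (metis prefixE prefix_length_prefix)
    then show ?thesis using pq by auto
  next
    case False
    then have "length (p @ v) \<le> length (a @ m)" using assms(2) by simp
    moreover have "prefix (p @ v) (a @ m @ c)" "prefix (a @ m) (a @ m @ c)" by (simp add: pq, simp)
    ultimately obtain r where "a @ m = (p @ v) @ r" by (metis prefixE prefix_length_prefix)
    then show ?thesis by auto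
  qed
qed

text \<open>A factor longer than two blocks contains a whole block.  With blocks that all contain \<open>u\<close>, this is
  how recurrence is recognised.\<close>

lemma sublist_of_concat:
  assumes "\<And>b. b \<in> set bs \<Longrightarrow> sublist u b \<and> length b \<le> n"
    and "sublist v (concat bs)" "2 * n < length v"
  shows "sublist u v"
  using assms
proof (induction bs)
  case Nil then show ?case by simp
next
  case (Cons b bs)
  have b: "sublist u b" "length b \<le> n" using Cons.prems(1) by auto
  consider "sublist v b" | "sublist v (concat bs)"
    | v1 v2 where "v = v1 @ v2" "suffix v1 b" "prefix v2 (concat bs)"
    using Cons.prems(2) by (auto simp: sublist_append)
  then show ?case
  proof cases
    case 1 then show ?thesis using Cons.prems(3) b sublist_length_le[of v b] by linarith
  next
    case 2 then show ?thesis using Cons by simp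
  next
    case 3
    have "length v1 \<le> n" using 3(2) b suffix_length_le by fastforce
    then have v2: "n < length v2" using Cons.prems(3) 3 by simp
    then obtain b' bs' where bs: "bs = b' # bs'" using 3(3) by (cases bs) auto
    have b': "sublist u b'" "length b' \<le> n" using Cons.prems(1) bs by auto
    have "prefix b' v2" using 3(3) v2 b' bs
      by (metis concat.simps(2) less_imp_le_nat order_trans prefixI prefix_length_prefix)
    then show ?thesis using b' 3(1)
      by (meson prefix_imp_sublist sublist_append sublist_order.order.trans)
  qed
qed

lemma card_concatenations:
  assumes "finite U" "finite V" "\<And>x. x \<in> U \<Longrightarrow> length x = n"
  shows "card {x @ g @ y | x y. x \<in> U \<and> y \<in> V} = card U * card V"
    and "finite {x @ g @ y | x y. x \<in> U \<and> y \<in> V}"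
proof -
  have eq: "{x @ g @ y | x y. x \<in> U \<and> y \<in> V} = (\<lambda>(x, y). x @ g @ y) ` (U \<times> V)" by auto
  have "inj_on (\<lambda>(x, y). x @ g @ y) (U \<times> V)"
    by (auto simp: inj_on_def assms(3))
  then show "card {x @ g @ y | x y. x \<in> U \<and> y \<in> V} = card U * card V"
    unfolding eq by (simp add: card_image card_cartesian_product)
  show "finite {x @ g @ y | x y. x \<in> U \<and> y \<in> V}"
    unfolding eq using assms by simp
qed

text \<open>The middle word \<open>g\<close> enters the bound additively.  A factor that starts in \<open>x\<close> is given by its start
  and the pair \<open>(x, y)\<close>; a factor inside \<open>g\<close> is given by its start alone; one that runs from \<open>g\<close> into
  \<open>y\<close>, or starts in \<open>y\<close>, is given by fewer than \<open>N\<close> positions and \<open>y\<close>.  The additive form is essential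
  since the pads that are used for \<open>g\<close> can be about as long as \<open>W k\<close> is large.\<close>

lemma card_factors_of_concatenations:
  assumes fin: "finite U" "finite V" and ne: "U \<noteq> {}"
    and len: "\<And>x. x \<in> U \<Longrightarrow> length x = N" "\<And>y. y \<in> V \<Longrightarrow> length y = N"
    and n: "1 \<le> n" "n \<le> N"
  shows "card {v. length v = n \<and> (\<exists>x\<in>U. \<exists>y\<in>V. sublist v (x @ g @ y))}
           \<le> 3 * (N * (card U * card V)) + length g + 1" (is "card ?V \<le> _")
    and "finite {v. length v = n \<and> (\<exists>x\<in>U. \<exists>y\<in>V. sublist v (x @ g @ y))}"
proof -
  \<comment> \<open>The four sets collect the factors that start in \<open>x\<close>, lie in \<open>g\<close>, run from \<open>g\<close> into \<open>y\<close>, and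
    start in \<open>y\<close>.\<close>
  define A1 where "A1 = (\<lambda>(i, x, y). take n (drop i (x @ g @ y))) ` ({..<N} \<times> U \<times> V)"
  define A2 where "A2 = (\<lambda>i. take n (drop i g)) ` {..length g}"
  define A3 where "A3 = (\<lambda>(i, y). take n (drop (length g - i) g @ y)) ` ({..<N} \<times> V)"
  define A4 where "A4 = (\<lambda>(i, y). take n (drop i y)) ` ({..<N} \<times> V)"
  have finA: "finite A1" "finite A2" "finite A3" "finite A4"
    using fin by (auto simp: A1_def A2_def A3_def A4_def)
  have "?V \<subseteq> A1 \<union> A2 \<union> A3 \<union> A4"
  proof
    fix v assume "v \<in> ?V"
    then obtain x y p q where v: "length v = n" "x \<in> U" "y \<in> V" "x @ g @ y = p @ v @ q"
      by (auto simp: sublist_def)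
    define i where "i = length p"
    have v_eq: "v = take n (drop i (x @ g @ y))" using v by (simp add: i_def)
    have "length (x @ g @ y) = length (p @ v @ q)" using v(4) by simp
    then have bound: "i + n \<le> N + (length g + N)" using v(1-3) len by (simp add: i_def)
    consider "i < N" | "N \<le> i" "i - N + n \<le> length g"
      | "N \<le> i" "i - N \<le> length g" "length g < i - N + n" | "N + length g < i" by linarith
    then show "v \<in> A1 \<union> A2 \<union> A3 \<union> A4"
    proof cases
      case 1
      have "(\<lambda>(i, x, y). take n (drop i (x @ g @ y))) (i, x, y) \<in> A1"
        unfolding A1_def by (rule imageI) (use 1 v in simp)
      then have "v \<in> A1" by (simp only: prod.case v_eq[symmetric])
      then show ?thesis by simp
    next
      case 2
      then have "v = take n (drop (i - N) g)" using v_eq len(1)[OF v(2)] by simp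
      moreover have "take n (drop (i - N) g) \<in> A2"
        unfolding A2_def by (rule imageI) (use 2 in simp)
      ultimately have "v \<in> A2" by (simp only:)
      then show ?thesis by simp
    next
      case 3
      then have "v = take n (drop (length g - (length g - (i - N))) g @ y)"
        using v_eq len(1)[OF v(2)] by simp
      moreover have "(\<lambda>(i, y). take n (drop (length g - i) g @ y)) (length g - (i - N), y) \<in> A3"
        unfolding A3_def by (rule imageI) (use 3 n v(3) in auto)
      ultimately have "v \<in> A3" by (simp only: prod.case)
      then show ?thesis by simp
    next
      case 4
      then have "v = take n (drop (i - N - length g) y)"
        using v_eq len(1)[OF v(2)] by simp
      moreover have "(\<lambda>(i, y). take n (drop i y)) (i - N - length g, y) \<in> A4"
        unfolding A4_def by (rule imageI) (use 4 n v(3) bound in auto)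
      ultimately have "v \<in> A4" by (simp only: prod.case)
      then show ?thesis by simp
    qed
  qed
  note sub = this
  show "finite ?V" using sub finA finite_subset by blast
  have "card A1 \<le> N * (card U * card V)" unfolding A1_def
    by (rule order_trans[OF card_image_le]) (use fin in \<open>auto simp: card_cartesian_product\<close>)
  moreover have "card A2 \<le> length g + 1" unfolding A2_def
    by (rule order_trans[OF card_image_le]) auto
  moreover have "card A3 \<le> N * card V" unfolding A3_def
    by (rule order_trans[OF card_image_le]) (use fin in \<open>auto simp: card_cartesian_product\<close>)
  moreover have "card A4 \<le> N * card V" unfolding A4_def
    by (rule order_trans[OF card_image_le]) (use fin in \<open>auto simp: card_cartesian_product\<close>)
  moreover have "card V \<le> card U * card V" using ne fin
    by (metis Suc_leI card_gt_0_iff mult.commute mult.right_neutral mult_le_mono2 One_nat_def)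
  then have "N * card V \<le> N * (card U * card V)" by simp
  moreover have "card ?V \<le> card (A1 \<union> A2 \<union> A3 \<union> A4)" using sub finA by (intro card_mono) auto
  moreover have "card (A1 \<union> A2 \<union> A3 \<union> A4) \<le> card A1 + card A2 + card A3 + card A4"
    by (meson card_Un_le order_trans add_le_mono le_refl)
  ultimately show "card ?V \<le> 3 * (N * (card U * card V)) + length g + 1" by linarith
qed

section \<open>Towers of block codes\<close>

text \<open>\<open>pad k\<close> is the pad that is waiting at stage \<open>k\<close>.  It stays unchanged until it is short compared with
  the words, namely of length at most \<open>k\<close>.  Then it is inserted into all words of the next stage, and
  the new pad lists these words.  Holding back the pad, instead of inserting a pad at every stage,
  means that at stage \<open>k\<close> there is just one word, the waiting pad, that can later separate words of
  stage \<open>k\<close> without being itself built from words of stage \<open>k + 1\<close>.\<close>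

locale block_tower =
  fixes W C :: "nat \<Rightarrow> 'a list set" and pad :: "nat \<Rightarrow> 'a list"
  assumes W_0: "finite (W 0)" "W 0 \<noteq> {}" "\<And>u. u \<in> W 0 \<Longrightarrow> length u = 1"
    and C_sub: "C k \<subseteq> W k" and C_ne: "C k \<noteq> {}"
    and W_Suc: "W (Suc k) =
      {x @ (if length (pad k) \<le> k then pad k else []) @ y | x y. x \<in> C k \<and> y \<in> W k}"
    and pad_0: "pad 0 = []"
    and pad_keep: "k < length (pad k) \<Longrightarrow> pad (Suc k) = pad k"
    and pad_new: "length (pad k) \<le> k \<Longrightarrow>
      \<exists>bs. distinct bs \<and> set bs = W (Suc k) \<and> pad (Suc k) = concat bs"
begin

definition insertion :: "nat \<Rightarrow> 'a list" where
  "insertion k = (if length (pad k) \<le> k then pad k else [])"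

primrec len :: "nat \<Rightarrow> nat" where
  "len 0 = 1"
| "len (Suc k) = 2 * len k + length (insertion k)"

lemma W_Suc': "W (Suc k) = {x @ insertion k @ y | x y. x \<in> C k \<and> y \<in> W k}"
  unfolding W_Suc insertion_def by (rule refl)

lemma W_ne: "W k \<noteq> {}"
  using C_sub C_ne by blast

lemma length_W: "u \<in> W k \<Longrightarrow> length u = len k"
proof (induction k arbitrary: u)
  case (Suc k)
  then obtain x y where "u = x @ insertion k @ y" "x \<in> W k" "y \<in> W k"
    unfolding W_Suc' using C_sub by blast
  then show ?case using Suc.IH[of x] Suc.IH[of y] by simp
qed (simp add: W_0)

lemma length_C: "u \<in> C k \<Longrightarrow> length u = len k"
  using C_sub length_W by blast

lemma finite_W: "finite (W k)"
proof (induction k)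
  case (Suc k)
  then have "finite (C k)" using C_sub finite_subset by blast
  then show ?case unfolding W_Suc' using Suc by (rule card_concatenations(2)) (rule length_C)
qed (rule W_0)

lemma finite_C: "finite (C k)"
  using C_sub finite_W finite_subset by blast

lemma card_W_Suc: "card (W (Suc k)) = card (C k) * card (W k)"
  unfolding W_Suc' by (rule card_concatenations) (auto intro: finite_C finite_W length_C)

lemma card_W_le_Suc: "card (W k) \<le> card (W (Suc k))"
  using C_ne[of k] finite_C[of k] by (simp add: card_W_Suc Suc_leI card_gt_0_iff)

lemma len_lower: "2 ^ k \<le> len k"
  by (induction k) auto

text \<open>An insertion at stage \<open>k\<close> has length at most \<open>k\<close>; the term \<open>k + 1\<close> in the inductive claim absorbs
  the sum of these lengths, weighted by the later doublings.\<close>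

lemma len_upper: "len k \<le> 2 * 2 ^ k"
proof -
  have "len k + k + 1 \<le> 2 * 2 ^ k"
  proof (induction k)
    case (Suc k)
    have "length (insertion k) \<le> k" by (simp add: insertion_def)
    then have "len (Suc k) + Suc k + 1 \<le> 2 * (len k + k + 1)" by simp
    then show ?case using Suc by simp
  qed simp
  then show ?thesis by simp
qed

text \<open>A waiting pad was created at an earlier stage as a list without repetition of all words of that
  stage, and the number and the length of the words do not decrease.\<close>

lemma length_pad: "length (pad k) \<le> len k * card (W k)"
proof (induction k)
  case (Suc k)
  show ?case
  proof (cases "length (pad k) \<le> k")
    case True
    then obtain bs where bs: "distinct bs" "set bs = W (Suc k)" "pad (Suc k) = concat bs"
      using pad_new by blast
    then have "length (pad (Suc k)) = sum_list (map (\<lambda>_. len (Suc k)) bs)"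
      unfolding length_concat bs(3)
      by (intro arg_cong[where f = sum_list] map_cong refl) (use bs length_W in blast)
    also have "\<dots> = len (Suc k) * card (W (Suc k))"
      using bs by (simp add: sum_list_triv distinct_card[symmetric])
    finally show ?thesis by simp
  next
    case False
    then have "length (pad (Suc k)) \<le> len k * card (W k)" using Suc pad_keep by simp
    also have "\<dots> \<le> len (Suc k) * card (W (Suc k))"
      using card_W_le_Suc by (intro mult_mono) auto
    finally show ?thesis .
  qed
qed (simp add: pad_0)

lemma W_suffix_Suc: "u \<in> W k \<Longrightarrow> \<exists>v \<in> W (Suc k). suffix u v"
proof -
  assume u: "u \<in> W k"
  obtain x where "x \<in> C k" using C_ne by blast
  then have "x @ insertion k @ u \<in> W (Suc k)" unfolding W_Suc' using u by blast
  moreover have "suffix u (x @ insertion k @ u)" by (metis append_assoc suffixI)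
  ultimately show ?thesis by blast
qed

lemma W_suffix: "u \<in> W k \<Longrightarrow> k \<le> m \<Longrightarrow> \<exists>v \<in> W m. suffix u v"
proof (induction m)
  case (Suc m)
  then show ?case
    by (metis W_suffix_Suc le_Suc_eq suffix_order.dual_order.trans suffix_order.order_refl)
qed auto

definition language :: "'a list set" where
  "language = {v. \<exists>m. \<exists>u \<in> W m. sublist v u}"

lemma W_language: "u \<in> W k \<Longrightarrow> u \<in> language"
  by (auto simp: language_def)

lemma language_sublist: "v \<in> language \<Longrightarrow> sublist u v \<Longrightarrow> u \<in> language"
  unfolding language_def using sublist_order.order.trans by blast

lemma language_late:
  assumes "v \<in> language"
  obtains m u where "k \<le> m" "u \<in> W m" "sublist v u"
proof -
  from assms obtain m u where u: "u \<in> W m" "sublist v u" by (auto simp: language_def)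
  obtain u' where "u' \<in> W (max k m)" "suffix u u'" using W_suffix[OF u(1), of "max k m"] by auto
  then show ?thesis using u(2) that[of "max k m" u'] by (meson max.cobounded1 sublist_order.order.trans suffix_imp_sublist)
qed

text \<open>A waiting pad does not change while the stage, and with it the admissible length, increases.\<close>

lemma insertion_occurs: "\<exists>s\<ge>m. length (pad s) \<le> s"
proof (rule ccontr)
  assume no: "\<not> (\<exists>s\<ge>m. length (pad s) \<le> s)"
  have const: "pad (m + t) = pad m" for t
  proof (induction t)
    case (Suc t)
    have "pad (Suc (m + t)) = pad (m + t)" by (rule pad_keep) (use no in \<open>meson le_add1 not_le\<close>)
    then show ?case using Suc by simp
  qed simp
  have "\<not> length (pad (m + length (pad m))) \<le> m + length (pad m)" using no by simp
  then show False unfolding const by simp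
qed

text \<open>From some stage on every pad contains \<open>u\<close>.  Once such a pad has been inserted, every word of the
  next stage \<open>s + 1\<close> contains \<open>u\<close>, and everything that is built afterwards, including the later pads,
  is a concatenation of words of stage \<open>s + 1\<close>.\<close>

lemma language_recurrent:
  assumes "u \<in> language"
  shows "\<exists>B. \<forall>v \<in> language. B < length v \<longrightarrow> sublist u v"
proof -
  from assms obtain m a where a: "a \<in> W m" "sublist u a" by (auto simp: language_def)
  have in_pad_new: "sublist u (concat bs)" if bs: "set bs = W j" and j: "m \<le> j" for bs j
  proof -
    obtain b where b: "b \<in> W j" "suffix a b" using W_suffix[OF a(1) j] by blast
    then obtain bs1 bs2 where "bs = bs1 @ b # bs2" using bs by (metis split_list)
    then have "sublist b (concat bs)" by simp
    then show ?thesis using a(2) b(2) by (meson suffix_imp_sublist sublist_order.order.trans)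
  qed
  obtain s1 where s1: "m \<le> s1" "length (pad s1) \<le> s1" using insertion_occurs by blast
  have in_pad: "sublist u (pad s)" if "Suc s1 \<le> s" for s
    using that
  proof (induction s rule: dec_induct)
    case base
    then show ?case using pad_new[OF s1(2)] in_pad_new s1(1) by force
  next
    case (step s)
    show ?case
    proof (cases "length (pad s) \<le> s")
      case True
      then show ?thesis using pad_new[OF True] in_pad_new[of _ "Suc s"] s1(1) step.hyps by force
    next
      case False
      then show ?thesis using pad_keep step.IH by simp
    qed
  qed
  obtain s where s: "Suc s1 \<le> s" "length (pad s) \<le> s" using insertion_occurs by blast
  have insertion_s: "insertion s = pad s" using s by (simp add: insertion_def)
  \<comment> \<open>\<open>star\<close> is the set of concatenations of short words that contain \<open>u\<close>; it contains all words and
    all pads from stage \<open>s + 1\<close> on.\<close>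
  define blocks where "blocks = {b. sublist u b \<and> length b \<le> len (Suc s)}"
  define star where "star = {concat bs | bs. set bs \<subseteq> blocks}"
  have star_append: "x @ y \<in> star" if "x \<in> star" "y \<in> star" for x y
    using that unfolding star_def by clarsimp (metis concat_append le_sup_iff set_append)
  have star_nil: "[] \<in> star" unfolding star_def by (intro CollectI exI[of _ "[]"]) simp
  have star_concat: "concat bs \<in> star" if "set bs \<subseteq> star" for bs
    using that by (induction bs) (auto simp: star_nil star_append)
  have base: "W (Suc s) \<subseteq> star"
  proof
    fix b assume b: "b \<in> W (Suc s)"
    then have "sublist u b" using in_pad[OF s(1)] insertion_s unfolding W_Suc'
      by (auto simp: sublist_append)
    then have "b \<in> blocks" using b length_W blocks_def by auto
    then show "b \<in> star" unfolding star_def by (force intro: exI[of _ "[b]"])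
  qed
  have all: "W j \<subseteq> star \<and> pad j \<in> star" if "Suc s \<le> j" for j
    using that
  proof (induction j rule: dec_induct)
    case base
    then show ?case using pad_new[OF s(2)] \<open>W (Suc s) \<subseteq> star\<close> star_concat by fastforce
  next
    case (step j)
    have "insertion j \<in> star" using step star_nil by (simp add: insertion_def)
    then have W: "W (Suc j) \<subseteq> star" using step C_sub star_append unfolding W_Suc' by blast
    then show ?case using step pad_keep[of j] pad_new[of j] star_concat
      by (metis not_le)
  qed
  show ?thesis
  proof (intro exI ballI impI)
    fix v assume v: "v \<in> language" "2 * len (Suc s) < length v"
    obtain j x where x: "Suc s \<le> j" "x \<in> W j" "sublist v x" using language_late v(1) by metis
    then obtain bs where "x = concat bs" "set bs \<subseteq> blocks" using all star_def by blast
    then show "sublist u v" using sublist_of_concat[of bs u "len (Suc s)" v] x v(2)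
      by (auto simp: blocks_def)
  qed
qed

text \<open>Seen from stage \<open>k\<close>, a later word is an alternating sequence of words of \<open>C k\<close> and \<open>W k\<close>, beginning
  in \<open>C k\<close> and ending in \<open>W k\<close>, where neighbours are separated by nothing or by the pad that waits at
  stage \<open>k\<close>.\<close>

definition gaps :: "nat \<Rightarrow> 'a list set" where
  "gaps k = {[], pad k}"

inductive_set chain :: "nat \<Rightarrow> 'a list set" for k where
  base: "x \<in> C k \<Longrightarrow> g \<in> gaps k \<Longrightarrow> y \<in> W k \<Longrightarrow> x @ g @ y \<in> chain k"
| join: "s \<in> chain k \<Longrightarrow> h \<in> gaps k \<Longrightarrow> t \<in> chain k \<Longrightarrow> s @ h @ t \<in> chain k"

lemma chain_append: "s \<in> chain k \<Longrightarrow> t \<in> chain k \<Longrightarrow> s @ t \<in> chain k"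
  using chain.join[of s k "[]" t] by (simp add: gaps_def)

lemma chain_concat: "set bs \<subseteq> chain k \<Longrightarrow> bs \<noteq> [] \<Longrightarrow> concat bs \<in> chain k"
proof (induction bs)
  case (Cons b bs)
  then show ?case by (cases "bs = []") (auto simp: chain_append)
qed simp

lemma chain_starts: "s \<in> chain k \<Longrightarrow> \<exists>x \<in> C k. \<exists>t. s = x @ t"
  by (induction rule: chain.induct) (blast, metis append_assoc)

lemma chain_ends: "s \<in> chain k \<Longrightarrow> \<exists>y \<in> W k. \<exists>t. s = t @ y"
proof (induction rule: chain.induct)
  case (base x g y)
  then show ?case by (intro bexI[of _ y] exI[of _ "x @ g"]) auto
next
  case (join s h t)
  then obtain y t' where "y \<in> W k" "t = t' @ y" by blast
  then show ?case by (intro bexI[of _ y] exI[of _ "s @ h @ t'"]) auto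
qed

text \<open>A pad created after stage \<open>k\<close> lists words of a later stage, so it is itself such a sequence.\<close>

lemma W_pad_chain:
  assumes "Suc k \<le> m"
  shows "W m \<subseteq> chain k \<and> pad m \<in> gaps k \<union> chain k"
  using assms
proof (induction m rule: dec_induct)
  case base
  have "insertion k \<in> gaps k" by (simp add: insertion_def gaps_def)
  then have W: "W (Suc k) \<subseteq> chain k" unfolding W_Suc' using chain.base by blast
  moreover have "pad (Suc k) \<in> gaps k \<union> chain k"
  proof (cases "length (pad k) \<le> k")
    case True
    then show ?thesis using pad_new[OF True] W W_ne[of "Suc k"] chain_concat by (metis UnCI set_empty2)
  next
    case False then show ?thesis using pad_keep by (simp add: gaps_def)
  qed
  ultimately show ?case by blast
next
  case (step m)
  have "insertion m \<in> gaps k \<union> chain k" using step by (auto simp: insertion_def gaps_def)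
  then have W: "W (Suc m) \<subseteq> chain k" using step C_sub[of m] unfolding W_Suc'
    by (auto intro: chain.join chain_append)
  moreover have "pad (Suc m) \<in> gaps k \<union> chain k"
  proof (cases "length (pad m) \<le> m")
    case True
    then show ?thesis using pad_new[OF True] W W_ne[of "Suc m"] chain_concat by (metis UnCI set_empty2)
  next
    case False then show ?thesis using pad_keep step by simp
  qed
  ultimately show ?case by blast
qed

text \<open>A word of length at most \<open>len k\<close> meets at most two of the blocks, and these are neighbours.\<close>

lemma sublist_chain:
  assumes "s \<in> chain k" "sublist v s" "length v \<le> len k"
  shows "\<exists>x \<in> C k. \<exists>y \<in> W k. \<exists>g \<in> gaps k. sublist v (x @ g @ y) \<or> sublist v (y @ g @ x)"
  using assms
proof (induction rule: chain.induct)
  case (base x g y)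
  then show ?case by blast
next
  case (join s h t)
  obtain y s' where y: "y \<in> W k" "s = s' @ y" using chain_ends join by blast
  obtain x t' where x: "x \<in> C k" "t = x @ t'" using chain_starts join by blast
  have "sublist v (s' @ y) \<or> sublist v (y @ h @ x @ t')"
    using sublist_overlap[of v s' y "h @ x @ t'"] join.prems y x length_W by simp
  moreover have "sublist v (y @ h @ x) \<or> sublist v (x @ t')" if "sublist v (y @ h @ x @ t')"
    using sublist_overlap[of v "y @ h" x t'] that join.prems x length_C by simp
  ultimately consider "sublist v s" | "sublist v (y @ h @ x)" | "sublist v t" using x y by blast
  then show ?case
  proof cases
    case 2
    then show ?thesis using x(1) y(1) join.hyps by blast
  qed (use join in blast)+
qed

text \<open>There are four families of neighbours: two orders of the blocks and two gaps.  With
  \<open>M = len k * card (W (Suc k))\<close>, which is positive and bounds the length of the pad, each family has at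
  most \<open>3 M\<close> factors plus the length of the gap plus \<open>1\<close>; together this is at most \<open>18 M\<close>.\<close>

lemma card_language:
  assumes n: "1 \<le> n" "n \<le> len k"
  shows "card {v \<in> language. length v = n} \<le> 18 * (len k * card (W (Suc k)))"
    and "finite {v \<in> language. length v = n}"
proof -
  define P where "P U V g = {v. length v = n \<and> (\<exists>x\<in>U. \<exists>y\<in>V. sublist v (x @ g @ y))}"
    for U V :: "'a list set" and g
  define M where "M = len k * card (W (Suc k))"
  have P: "finite (P (C k) (W k) g)" "card (P (C k) (W k) g) \<le> 3 * M + length g + 1"
      "finite (P (W k) (C k) g)" "card (P (W k) (C k) g) \<le> 3 * M + length g + 1" for g
  proof -
    have M: "len k * (card (C k) * card (W k)) = M" "len k * (card (W k) * card (C k)) = M"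
      by (simp_all add: M_def card_W_Suc mult.commute)
    show "finite (P (C k) (W k) g)" "card (P (C k) (W k) g) \<le> 3 * M + length g + 1"
      using card_factors_of_concatenations[OF finite_C[of k] finite_W[of k] C_ne length_C length_W n, where g = g]
      unfolding P_def M by simp_all
    show "finite (P (W k) (C k) g)" "card (P (W k) (C k) g) \<le> 3 * M + length g + 1"
      using card_factors_of_concatenations[OF finite_W[of k] finite_C[of k] W_ne length_W length_C n, where g = g]
      unfolding P_def M by simp_all
  qed
  let ?U = "P (C k) (W k) [] \<union> P (W k) (C k) [] \<union> P (C k) (W k) (pad k) \<union> P (W k) (C k) (pad k)"
  have sub: "{v \<in> language. length v = n} \<subseteq> ?U"
  proof
    fix v assume v: "v \<in> {v \<in> language. length v = n}"
    then have "v \<in> language" by simp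
    then obtain m u where u: "Suc k \<le> m" "u \<in> W m" "sublist v u" by (rule language_late)
    have "u \<in> chain k" using W_pad_chain[OF u(1)] u(2) by blast
    then obtain x y g where "x \<in> C k" "y \<in> W k" "g = [] \<or> g = pad k"
        "sublist v (x @ g @ y) \<or> sublist v (y @ g @ x)"
      using sublist_chain[of u k v] u(3) v n unfolding gaps_def by blast
    moreover have "length v = n" using v by simp
    ultimately show "v \<in> ?U" unfolding P_def by blast
  qed
  then show "finite {v \<in> language. length v = n}" 
    by (rule finite_subset) (simp add: P)
  have "card {v \<in> language. length v = n} \<le> card ?U" by (rule card_mono[OF _ sub]) (simp add: P)
  also have "\<dots> \<le> card (P (C k) (W k) []) + card (P (W k) (C k) []) + card (P (C k) (W k) (pad k)) + card (P (W k) (C k) (pad k))"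
    by (intro order_trans[OF card_Un_le] add_le_mono le_refl)
  also have "\<dots> \<le> 12 * M + 2 * length (pad k) + 4"
    using P(2)[of "[]"] P(4)[of "[]"] P(2)[of "pad k"] P(4)[of "pad k"] by simp
  also have "\<dots> \<le> 18 * M"
  proof -
    have "length (pad k) \<le> M" unfolding M_def
      using length_pad[of k] card_W_le_Suc[of k] by (meson le_trans mult_le_mono2)
    moreover have "1 \<le> M" unfolding M_def using n W_ne[of "Suc k"] finite_W[of "Suc k"]
      by (simp add: Suc_leI card_gt_0_iff del: len.simps)
    ultimately show ?thesis by simp
  qed
  finally show "card {v \<in> language. length v = n} \<le> 18 * (len k * card (W (Suc k)))" by (simp add: M_def)
qed

text \<open>By recurrence \<open>u\<close> occurs in the interior of a long word of the language, where it has a letter on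
  either side.\<close>

lemma language_extends:
  assumes "u \<in> language"
  shows "\<exists>x y. x # u @ [y] \<in> language"
proof -
  obtain B where B: "\<And>v. v \<in> language \<Longrightarrow> B < length v \<Longrightarrow> sublist u v"
    using language_recurrent assms by blast
  have "B + 2 < 2 ^ (B + 2)" by (rule less_exp)
  then have big: "B + 2 < len (B + 2)" using len_lower[of "B + 2"] by linarith
  obtain v where v: "v \<in> W (B + 2)" using W_ne by blast
  then have "length v \<ge> B + 3" using big length_W by simp
  then obtain a v' b where ab: "v = a # v' @ [b]"
    by (cases v; simp) (metis append_butlast_last_id list.size(3) not_less_eq_eq zero_le)
  have "sublist v' v" unfolding ab by (metis append_Cons append_Nil sublist_appendI)
  then have v': "v' \<in> language" using v W_language language_sublist by blast
  have "B < length v'" using \<open>length v \<ge> B + 3\<close> ab by simp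
  then have "sublist u v'" using B v' by blast
  then obtain p q where pq: "v' = p @ u @ q" by (auto simp: sublist_def)
  obtain p' x where x: "a # p = p' @ [x]" by (metis list.distinct(1) rev_exhaust)
  obtain y q' where y: "q @ [b] = y # q'" by (metis append_is_Nil_conv list.distinct(1) neq_Nil_conv)
  have "v = (a # p) @ u @ (q @ [b])" using ab pq by simp
  then have "v = p' @ (x # u @ [y]) @ q'" unfolding x y by simp
  then have "sublist (x # u @ [y]) v" by (metis sublist_appendI)
  then show ?thesis using v W_language language_sublist by blast
qed

end

section \<open>Words of prescribed complexity\<close>

text \<open>The least \<open>q\<close> with \<open>F' \<le> q * a\<close> overshoots by less than \<open>a\<close>, which is at most \<open>F'\<close> unless \<open>q = 1\<close>.
  In the latter case \<open>q * a = a \<le> 2 * F \<le> 2 * F'\<close>.\<close>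

lemma factor_quotient:
  fixes a F F' :: nat
  assumes "1 \<le> F" "F \<le> a" "a \<le> 2 * F" "F \<le> F'" "F' \<le> F * F"
  shows "\<exists>q. 1 \<le> q \<and> q \<le> a \<and> F' \<le> q * a \<and> q * a \<le> 2 * F'"
proof (cases "F' \<le> a")
  case True
  then show ?thesis using assms by (intro exI[of _ 1]) auto
next
  case False
  have *: "F' \<le> a * a" using assms mult_mono[of F a F a] by simp
  define q where "q = (LEAST q. F' \<le> q * a)"
  have q: "F' \<le> q * a" "q \<le> a" unfolding q_def using * by (auto intro: LeastI Least_le)
  have q1: "1 \<le> q" using q(1) assms by (cases q) auto
  have "\<not> F' \<le> (q - 1) * a" using not_less_Least[of "q - 1" "\<lambda>q. F' \<le> q * a"] q1 by (simp flip: q_def)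
  then have "q * a - a < F'" by (simp add: diff_mult_distrib)
  then show ?thesis using q q1 False by (intro exI[of _ q]) auto
qed

text \<open>The size of \<open>W k\<close> is kept within a factor \<open>2\<close> of \<open>f (2 ^ k)\<close> by the choice of the size of \<open>C k\<close>.
  The error does not accumulate because each step corrects towards the next value of \<open>f\<close>.\<close>

lemma block_tower_exists:
  fixes f :: "nat \<Rightarrow> nat"
  assumes mono: "mono f" and sub: "\<And>m n. f (m + n) \<le> f m * f n" and pos: "\<And>n. 1 \<le> f n"
  obtains W C :: "nat \<Rightarrow> nat list set" and pad where "block_tower W C pad"
    "\<And>k. f (2 ^ k) \<le> card (W k)" "\<And>k. card (W k) \<le> 2 * f (2 ^ k)"
proof -
  define F where "F k = f (2 ^ k)" for k
  have F: "1 \<le> F k" "F k \<le> F (Suc k)" "F (Suc k) \<le> F k * F k" for k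
    using pos mono sub[of "2 ^ k" "2 ^ k"] by (simp_all add: F_def monoD mult_2)
  \<comment> \<open>\<open>good\<close> collects what is required of the words of one stage, \<open>link\<close> relates two consecutive stages.
    A state also carries the set \<open>C\<close>, which is chosen together with \<open>W\<close> in view of the next value of \<open>f\<close>.\<close>
  define good where "good k W C \<longleftrightarrow> finite W \<and> (\<exists>N. \<forall>u\<in>W. length u = N) \<and>
      F k \<le> card W \<and> card W \<le> 2 * F k \<and> C \<subseteq> W \<and> C \<noteq> {} \<and>
      F (Suc k) \<le> card C * card W \<and> card C * card W \<le> 2 * F (Suc k)"
    for k and W C :: "nat list set"
  define P where "P k S \<longleftrightarrow> good k (fst S) (fst (snd S)) \<and>
      (k = 0 \<longrightarrow> snd (snd S) = [] \<and> fst S = (\<lambda>a. [a]) ` {..<f 1})"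
    for k :: nat and S :: "nat list set \<times> nat list set \<times> nat list"
  define link where "link k W C p W' p' \<longleftrightarrow>
      W' = {x @ (if length p \<le> k then p else []) @ y | x y. x \<in> C \<and> y \<in> W} \<and>
      (if length p \<le> k then \<exists>bs. distinct bs \<and> set bs = W' \<and> p' = concat bs else p' = p)"
    for k and W C W' :: "nat list set" and p p'
  define Q where "Q k S T \<longleftrightarrow>
      link k (fst S) (fst (snd S)) (snd (snd S)) (fst T) (snd (snd T))"
    for k and S T :: "nat list set \<times> nat list set \<times> nat list"
  have choose: "\<exists>C. good k W C"
    if W: "finite W" "\<exists>N. \<forall>u\<in>W. length u = N" "F k \<le> card W" "card W \<le> 2 * F k"
    for W :: "nat list set" and k
  proof -
    obtain q where q: "1 \<le> q" "q \<le> card W" "F (Suc k) \<le> q * card W" "q * card W \<le> 2 * F (Suc k)"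
      using factor_quotient[OF F(1) W(3,4) F(2,3)] by blast
    obtain C where C: "C \<subseteq> W" "card C = q" using q(2) by (meson obtain_subset_with_card_n)
    then have "C \<noteq> {}" using q(1) by auto
    then show ?thesis unfolding good_def using W C q by blast
  qed
  have "\<exists>S. \<forall>k. P k (S k) \<and> Q k (S k) (S (Suc k))"
  proof (rule dependent_nat_choice)
    define W where "W = (\<lambda>a :: nat. [a]) ` {..<f 1}"
    have W: "finite W" "card W = F 0" unfolding W_def F_def by (auto simp: card_image inj_on_def)
    have "\<exists>N. \<forall>u\<in>W. length u = N" unfolding W_def by auto
    then obtain C where "good 0 W C" using choose[of W 0] W by auto
    then have "P 0 (W, C, [])" unfolding P_def by (simp add: W_def)
    then show "\<exists>S. P 0 S" by blast
  next
    fix S :: "nat list set \<times> nat list set \<times> nat list" and k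
    assume S: "P k S"
    obtain W C p where S_eq: "S = (W, C, p)" by (cases S)
    have W: "good k W C" using S unfolding P_def S_eq by simp
    define g where "g = (if length p \<le> k then p else [])"
    define W' where "W' = {x @ g @ y | x y. x \<in> C \<and> y \<in> W}"
    obtain N where N: "\<And>u. u \<in> W \<Longrightarrow> length u = N" using W unfolding good_def by blast
    have CW: "C \<subseteq> W" and fin: "finite W" using W unfolding good_def by blast+
    then have finC: "finite C" by (rule finite_subset)
    have NC: "length u = N" if "u \<in> C" for u using N CW that by blast
    have W': "finite W'" "card W' = card C * card W"
      unfolding W'_def by (rule card_concatenations[OF finC fin NC]; assumption)+
    have "\<forall>u\<in>W'. length u = N + (length g + N)"
      unfolding W'_def using N NC by fastforce
    then have "\<exists>N'. \<forall>u\<in>W'. length u = N'" by blast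
    moreover have "F (Suc k) \<le> card W'" "card W' \<le> 2 * F (Suc k)"
      using W unfolding good_def W'(2) by blast+
    ultimately obtain C' where C': "good (Suc k) W' C'" using choose[OF W'(1)] by blast
    obtain bs where bs: "set bs = W'" "distinct bs" using finite_distinct_list[OF W'(1)] by blast
    define p' where "p' = (if length p \<le> k then concat bs else p)"
    have "P (Suc k) (W', C', p')" unfolding P_def using C' by simp
    moreover have "link k W C p W' p'"
      unfolding link_def g_def[symmetric] using bs by (simp add: W'_def p'_def) blast
    then have "Q k S (W', C', p')" unfolding Q_def S_eq by simp
    ultimately show "\<exists>T. P (Suc k) T \<and> Q k S T" by blast
  qed
  then obtain S where S: "\<And>k. P k (S k)" "\<And>k. Q k (S k) (S (Suc k))" by blast
  define W where "W k = fst (S k)" for k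
  define C where "C k = fst (snd (S k))" for k
  define pad where "pad k = snd (snd (S k))" for k
  have good: "good k (W k) (C k)" for k using S(1)[of k] by (simp add: P_def W_def C_def)
  have link: "link k (W k) (C k) (pad k) (W (Suc k)) (pad (Suc k))" for k
    using S(2)[of k] by (simp add: Q_def W_def C_def pad_def)
  have W0: "W 0 = (\<lambda>a. [a]) ` {..<f 1}" "pad 0 = []"
    using S(1)[of 0] by (simp_all add: P_def W_def pad_def)
  have "block_tower W C pad"
  proof
    show "finite (W 0)" unfolding W0 by simp
    have "0 \<in> {..<f 1}" using pos[of 1] by simp
    then show "W 0 \<noteq> {}" unfolding W0 by blast
    show "pad 0 = []" by (rule W0)
    show "length u = 1" if "u \<in> W 0" for u using that unfolding W0 by auto
    show "C k \<subseteq> W k" "C k \<noteq> {}" for k using good[of k] unfolding good_def by blast+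
    show "W (Suc k) = {x @ (if length (pad k) \<le> k then pad k else []) @ y |x y. x \<in> C k \<and> y \<in> W k}" for k
      using link[of k] unfolding link_def by blast
    show "pad (Suc k) = pad k" if "k < length (pad k)" for k
      using link[of k] that unfolding link_def by simp
    show "\<exists>bs. distinct bs \<and> set bs = W (Suc k) \<and> pad (Suc k) = concat bs" if "length (pad k) \<le> k" for k
      using link[of k] that unfolding link_def if_P[OF that] by blast
  qed
  moreover have "f (2 ^ k) \<le> card (W k)" "card (W k) \<le> 2 * f (2 ^ k)" for k
    using good[of k] unfolding good_def F_def by blast+
  ultimately show ?thesis using that by blast
qed

definition complexity :: "(int \<Rightarrow> 'a) \<Rightarrow> nat \<Rightarrow> nat" where
  "complexity w n = card (range (\<lambda>i. window w i n))"

definition uniformly_recurrent :: "(int \<Rightarrow> 'a) \<Rightarrow> bool" where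
  "uniformly_recurrent w \<longleftrightarrow>
     (\<forall>i n. \<exists>r. \<forall>j. \<exists>k\<le>r. window w (j + int k) n = window w i n)"

lemma complexity_mono:
  assumes "finite (range (\<lambda>i. window w i n))" "m \<le> n"
  shows "complexity w m \<le> complexity w n"
proof -
  have "window w i m = take m (window w i n)" for i
    using assms(2) by (auto simp: list_eq_iff_nth_eq)
  then have "range (\<lambda>i. window w i m) = take m ` range (\<lambda>i. window w i n)" by auto
  then show ?thesis unfolding complexity_def using assms(1) card_image_le by metis
qed

text \<open>A length \<open>n\<close> is compared with the stage \<open>k\<close> for which \<open>n \<le> 2 ^ k \<le> 2 n\<close>: the words of stage \<open>k\<close> have
  length between \<open>n\<close> and \<open>4 n\<close>, and \<open>W (k + 1)\<close> has at most \<open>2 f (4 n)\<close> elements.  The constant is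
  \<open>144 = 18 * 4 * 2\<close>.\<close>

theorem recurrent_word_of_complexity:
  fixes f :: "nat \<Rightarrow> nat"
  assumes mono: "mono f" and sub: "\<And>m n. f (m + n) \<le> f m * f n" and pos: "\<And>n. 1 \<le> f n"
  obtains w :: "int \<Rightarrow> nat" where "\<And>n. finite (range (\<lambda>i. window w i n))"
    "uniformly_recurrent w"
    "\<And>n. 1 \<le> n \<Longrightarrow> complexity w n \<le> 144 * n * f (4 * n)"
    "\<And>n. 1 \<le> n \<Longrightarrow> f n \<le> complexity w (4 * n)"
proof -
  obtain W C :: "nat \<Rightarrow> nat list set" and pad where "block_tower W C pad"
    and card_W: "\<And>k. f (2 ^ k) \<le> card (W k)" "\<And>k. card (W k) \<le> 2 * f (2 ^ k)"
    using block_tower_exists[OF assms] by blast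
  then interpret block_tower W C pad by simp
  obtain w where w: "\<And>i n. window w i n \<in> language"
  proof (rule bi_infinite_word[of language])
    show "language \<noteq> {}" using W_language W_ne by blast
  qed (use language_sublist language_extends in blast)+
  have occurs: "\<exists>r. \<forall>j. \<exists>k\<le>r. window w (j + int k) (length u) = u" if u: "u \<in> language" for u
  proof -
    obtain B where B: "\<And>v. v \<in> language \<Longrightarrow> B < length v \<Longrightarrow> sublist u v"
      using language_recurrent u by blast
    have "\<exists>k\<le>B+1. window w (j + int k) (length u) = u" for j
    proof -
      have "sublist u (window w j (B + 1))" using B w by simp
      then obtain k where k: "u = window w (j + int k) (length u)" "k + length u \<le> B + 1"
        by (rule sublist_windowE)
      show ?thesis by (rule exI[of _ k]) (use k in auto)
    qed
    then show ?thesis by blast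
  qed
  have range_eq: "range (\<lambda>i. window w i n) = {v \<in> language. length v = n}" for n
  proof
    show "{v \<in> language. length v = n} \<subseteq> range (\<lambda>i. window w i n)"
    proof
      fix u assume u: "u \<in> {v \<in> language. length v = n}"
      then obtain k where "window w (0 + int k) (length u) = u" using occurs by blast
      then have "window w (int k) n = u" using u by simp
      then show "u \<in> range (\<lambda>i. window w i n)" by blast
    qed
  qed (use w in auto)
  have level: "\<exists>k. n \<le> 2 ^ k \<and> 2 ^ k \<le> 2 * n" if "1 \<le> n" for n :: nat
  proof -
    define k where "k = (LEAST k. n \<le> 2 ^ k)"
    have k: "n \<le> 2 ^ k" unfolding k_def by (rule LeastI[of _ n]) (simp add: less_imp_le)
    have "2 ^ k \<le> 2 * n"
    proof (cases k)
      case (Suc j)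
      then have "\<not> n \<le> 2 ^ j" using not_less_Least[of j "\<lambda>k. n \<le> 2 ^ k"] by (simp flip: k_def)
      then show ?thesis using Suc by simp
    qed (use that in simp)
    then show ?thesis using k by blast
  qed
  have fin: "finite (range (\<lambda>i. window w i n))" for n
  proof (cases n)
    case (Suc m)
    have "n \<le> len n" using len_lower[of n] less_exp[of n] by linarith
    then show ?thesis unfolding range_eq using card_language(2)[of n n] Suc by simp
  qed simp
  moreover have "uniformly_recurrent w"
    unfolding uniformly_recurrent_def using occurs[OF w] by simp
  moreover have "complexity w n \<le> 144 * n * f (4 * n)" if n: "1 \<le> n" for n
  proof -
    obtain k where k: "n \<le> 2 ^ k" "2 ^ k \<le> 2 * n" using level[OF n] by blast
    have "complexity w n \<le> 18 * (len k * card (W (Suc k)))"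
      unfolding complexity_def range_eq using k len_lower[of k] n by (intro card_language) auto
    also have "\<dots> \<le> 18 * ((4 * n) * (2 * f (4 * n)))"
    proof (intro mult_le_mono le_refl)
      show "len k \<le> 4 * n" using len_upper[of k] k by linarith
      have "2 ^ Suc k \<le> 4 * n" using k(2) by simp
      then have "f (2 ^ Suc k) \<le> f (4 * n)" by (rule monoD[OF mono])
      then show "card (W (Suc k)) \<le> 2 * f (4 * n)" using card_W(2)[of "Suc k"] by linarith
    qed
    finally show ?thesis by simp
  qed
  moreover have "f n \<le> complexity w (4 * n)" if n: "1 \<le> n" for n
  proof -
    obtain k where k: "n \<le> 2 ^ k" "2 ^ k \<le> 2 * n" using level[OF n] by blast
    have "f n \<le> f (2 ^ k)" by (rule monoD[OF mono k(1)])
    also have "\<dots> \<le> card (W k)" by (rule card_W)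
    also have "\<dots> \<le> complexity w (len k)" unfolding complexity_def
    proof (rule card_mono[OF fin])
      show "W k \<subseteq> range (\<lambda>i. window w i (len k))"
        unfolding range_eq using W_language length_W by blast
    qed
    also have "\<dots> \<le> complexity w (4 * n)"
      using k len_upper[of k] by (intro complexity_mono fin) linarith
    finally show ?thesis .
  qed
  ultimately show ?thesis using that by blast
qed

section \<open>Matrices indexed by pairs of integers\<close>

definition scale :: "'k::field \<Rightarrow> (nat \<Rightarrow> 'k) \<Rightarrow> nat \<Rightarrow> 'k" where
  "scale c a = (\<lambda>n. c * a n)"

interpretation fv: vector_space "scale :: 'k::field \<Rightarrow> _"
  by standard (auto simp: scale_def fun_eq_iff algebra_simps)

text \<open>Matrices indexed by pairs of integers are stored as functions on the natural numbers through a
  bijection; only \<open>entry\<close> and \<open>of_entries\<close> depend on the choice of the bijection.\<close>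

definition entry_code :: "int \<Rightarrow> int \<Rightarrow> nat" where
  "entry_code i j = prod_encode (int_encode i, int_encode j)"

definition entry :: "(nat \<Rightarrow> 'k) \<Rightarrow> int \<Rightarrow> int \<Rightarrow> 'k" where
  "entry a i j = a (entry_code i j)"

definition of_entries :: "(int \<Rightarrow> int \<Rightarrow> 'k) \<Rightarrow> nat \<Rightarrow> 'k" where
  "of_entries F n = F (int_decode (fst (prod_decode n))) (int_decode (snd (prod_decode n)))"

lemma entry_of_entries [simp]: "entry (of_entries F) i j = F i j"
  by (simp add: entry_def of_entries_def entry_code_def)

lemma entry_eqI:
  assumes "\<And>i j. entry a i j = entry b i j"
  shows "a = b"
proof
  fix n
  have "n = entry_code (int_decode (fst (prod_decode n))) (int_decode (snd (prod_decode n)))"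
    by (simp add: entry_code_def)
  then show "a n = b n" using assms unfolding entry_def by metis
qed

lemma entry_add [simp]: "entry (a + b) i j = entry a i j + entry b i j"
  by (simp add: entry_def)

lemma entry_0 [simp]: "entry 0 i j = 0"
  by (simp add: entry_def)

lemma entry_scale [simp]: "entry (scale c a) i j = c * entry a i j"
  by (simp add: entry_def scale_def)

lemma entry_sum: "entry (sum F S) i j = (\<Sum>s\<in>S. entry (F s :: nat \<Rightarrow> 'k::field) i j)"
  by (induction S rule: infinite_finite_induct) (simp_all add: entry_def)

text \<open>The sum over the support of a row is meaningful as long as the rows of \<open>a\<close> are finitely supported,
  which holds for band matrices.\<close>

definition mat_mult :: "(nat \<Rightarrow> 'k::field) \<Rightarrow> (nat \<Rightarrow> 'k) \<Rightarrow> nat \<Rightarrow> 'k" where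
  "mat_mult a b = of_entries (\<lambda>i j. \<Sum>k | entry a i k \<noteq> 0. entry a i k * entry b k j)"

lemma entry_mat_mult:
  assumes "finite S" "\<And>k. k \<notin> S \<Longrightarrow> entry a i k = 0"
  shows "entry (mat_mult a b) i j = (\<Sum>k\<in>S. entry a i k * entry b k j)"
  unfolding mat_mult_def entry_of_entries using assms
  by (intro sum.mono_neutral_left) auto

section \<open>The algebra of a bi-infinite word\<close>

definition agree :: "(int \<Rightarrow> 'a) \<Rightarrow> nat \<Rightarrow> int \<Rightarrow> int \<Rightarrow> bool" where
  "agree w m i j \<longleftrightarrow> (\<forall>t. \<bar>t\<bar> \<le> int m \<longrightarrow> w (i + t) = w (j + t))"

lemma agree_window: "agree w m i j \<longleftrightarrow> window w (i - int m) (2 * m + 1) = window w (j - int m) (2 * m + 1)"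
proof
  assume a: "agree w m i j"
  show "window w (i - int m) (2 * m + 1) = window w (j - int m) (2 * m + 1)"
    unfolding window_eq_iff
  proof (intro allI impI)
    fix t assume "t < 2 * m + 1"
    then have "\<bar>int t - int m\<bar> \<le> int m" by linarith
    then have "w (i + (int t - int m)) = w (j + (int t - int m))" using a unfolding agree_def by blast
    then show "w (i - int m + int t) = w (j - int m + int t)" by (simp add: algebra_simps)
  qed
next
  assume a: "window w (i - int m) (2 * m + 1) = window w (j - int m) (2 * m + 1)"
  show "agree w m i j" unfolding agree_def
  proof (intro allI impI)
    fix t :: int assume "\<bar>t\<bar> \<le> int m"
    then have "nat (t + int m) < 2 * m + 1" and e: "int (nat (t + int m)) = t + int m" by linarith+
    then have "w (i - int m + int (nat (t + int m))) = w (j - int m + int (nat (t + int m)))"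
      using a unfolding window_eq_iff by blast
    then show "w (i + t) = w (j + t)" unfolding e by simp
  qed
qed

lemma agree_shift:
  assumes "agree w m i j" "\<bar>d\<bar> + int l \<le> int m"
  shows "agree w l (i + d) (j + d)"
  unfolding agree_def
proof (intro allI impI)
  fix t :: int assume "\<bar>t\<bar> \<le> int l"
  then have "\<bar>d + t\<bar> \<le> int m" using assms(2) by linarith
  then show "w (i + d + t) = w (j + d + t)" using assms(1) unfolding agree_def by (metis add.assoc)
qed

lemma agree_le: "agree w m i j \<Longrightarrow> l \<le> m \<Longrightarrow> agree w l i j"
  using agree_shift[of w m i j 0 l] by simp

lemma agree_sym: "agree w m i j \<Longrightarrow> agree w m j i"
  by (simp add: agree_def)

lemma agree_trans: "agree w m i j \<Longrightarrow> agree w m j k \<Longrightarrow> agree w m i k"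
  by (simp add: agree_def)

text \<open>One parameter bounds both the bandwidth and the radius of the window that determines an entry.
  Both add up under multiplication, so the spaces \<open>local_matrices w m\<close> filter the algebra.\<close>

definition local_matrices :: "(int \<Rightarrow> 'b) \<Rightarrow> nat \<Rightarrow> (nat \<Rightarrow> 'k::field) set" where
  "local_matrices w m = {a. (\<forall>i j. int m < \<bar>j - i\<bar> \<longrightarrow> entry a i j = 0) \<and>
               (\<forall>i i' d. agree w m i i' \<longrightarrow> entry a i (i + d) = entry a i' (i' + d))}"

lemma local_matrices_band: "a \<in> local_matrices w m \<Longrightarrow> int m < \<bar>j - i\<bar> \<Longrightarrow> entry a i j = 0"
  by (simp add: local_matrices_def)

lemma local_matrices_local: "a \<in> local_matrices w m \<Longrightarrow> agree w m i i' \<Longrightarrow> entry a i (i + d) = entry a i' (i' + d)"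
  by (simp add: local_matrices_def)

lemma local_matricesI:
  assumes "\<And>i j. int m < \<bar>j - i\<bar> \<Longrightarrow> entry a i j = 0"
    and "\<And>i i' d. agree w m i i' \<Longrightarrow> entry a i (i + d) = entry a i' (i' + d)"
  shows "a \<in> local_matrices w m"
  using assms by (simp add: local_matrices_def)

lemma local_matrices_mono:
  assumes "m \<le> n"
  shows "local_matrices w m \<subseteq> local_matrices w n"
proof
  fix a assume a: "a \<in> local_matrices w m"
  show "a \<in> local_matrices w n"
  proof (rule local_matricesI)
    show "entry a i j = 0" if "int n < \<bar>j - i\<bar>" for i j
      using local_matrices_band[OF a] that assms by simp
    show "entry a i (i + d) = entry a i' (i' + d)" if "agree w n i i'" for i i' d
      using local_matrices_local[OF a agree_le[OF that assms]] .
  qed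
qed

lemma local_matrices_subspace: "fv.subspace (local_matrices w m)"
proof (rule fv.subspaceI)
  show "0 \<in> local_matrices w m" by (rule local_matricesI) auto
  show "a + b \<in> local_matrices w m" if a: "a \<in> local_matrices w m" and b: "b \<in> local_matrices w m" for a b
  proof (rule local_matricesI)
    show "entry (a + b) i j = 0" if "int m < \<bar>j - i\<bar>" for i j
      using local_matrices_band[OF a that] local_matrices_band[OF b that] by simp
    show "entry (a + b) i (i + d) = entry (a + b) i' (i' + d)" if "agree w m i i'" for i i' d
      using local_matrices_local[OF a that] local_matrices_local[OF b that] by simp
  qed
  show "scale c a \<in> local_matrices w m" if a: "a \<in> local_matrices w m" for c a
  proof (rule local_matricesI)
    show "entry (scale c a) i j = 0" if "int m < \<bar>j - i\<bar>" for i j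
      using local_matrices_band[OF a that] by simp
    show "entry (scale c a) i (i + d) = entry (scale c a) i' (i' + d)" if "agree w m i i'" for i i' d
      using local_matrices_local[OF a that] by simp
  qed
qed

lemma local_matrices_row: "a \<in> local_matrices w m \<Longrightarrow> k \<notin> {i - int m..i + int m} \<Longrightarrow> entry a i k = 0"
  by (rule local_matrices_band) auto

lemma entry_mat_mult_local:
  assumes "a \<in> local_matrices w m"
  shows "entry (mat_mult a b) i j = (\<Sum>d\<in>{- int m..int m}. entry a i (i + d) * entry b (i + d) j)"
proof -
  have "entry (mat_mult a b) i j = (\<Sum>k\<in>{i - int m..i + int m}. entry a i k * entry b k j)"
    by (rule entry_mat_mult) (use local_matrices_row[OF assms] in auto)
  also have "{i - int m..i + int m} = (\<lambda>d. i + d) ` {- int m..int m}"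
    by (simp add: image_add_atLeastAtMost)
  also have "(\<Sum>k\<in>\<dots>. entry a i k * entry b k j) = (\<Sum>d\<in>{- int m..int m}. entry a i (i + d) * entry b (i + d) j)"
    by (subst sum.reindex) (auto simp: inj_on_def)
  finally show ?thesis .
qed

text \<open>An intermediate index lies within \<open>m\<close> of the row index, and a window of radius \<open>l\<close> around it is
  contained in the window of radius \<open>m + l\<close> around the row index.\<close>

lemma local_matrices_mat_mult:
  assumes a: "a \<in> local_matrices w m" and b: "b \<in> local_matrices w l"
  shows "mat_mult a b \<in> local_matrices w (m + l)"
proof (rule local_matricesI)
  fix i j assume far: "int (m + l) < \<bar>j - i\<bar>"
  have "entry a i (i + d) * entry b (i + d) j = 0" if "d \<in> {- int m..int m}" for d
  proof -
    have "- int m \<le> d" "d \<le> int m" using that by auto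
    then have "int l < \<bar>j - (i + d)\<bar>" using far by linarith
    then show ?thesis using local_matrices_band[OF b] by simp
  qed
  then show "entry (mat_mult a b) i j = 0" unfolding entry_mat_mult_local[OF a] by (intro sum.neutral) blast
next
  fix i i' e assume ag: "agree w (m + l) i i'"
  show "entry (mat_mult a b) i (i + e) = entry (mat_mult a b) i' (i' + e)"
    unfolding entry_mat_mult_local[OF a]
  proof (rule sum.cong)
    fix d assume d: "d \<in> {- int m..int m}"
    have "entry a i (i + d) = entry a i' (i' + d)"
      by (rule local_matrices_local[OF a agree_le[OF ag]]) simp
    moreover have "entry b (i + d) (i + d + (e - d)) = entry b (i' + d) (i' + d + (e - d))"
      by (rule local_matrices_local[OF b agree_shift[OF ag]]) (use d in auto)
    ultimately show "entry a i (i + d) * entry b (i + d) (i + e) = entry a i' (i' + d) * entry b (i' + d) (i' + e)"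
      by simp
  qed simp
qed

text \<open>All intermediate indices lie within \<open>m + l\<close> of the row index, so both sides are finite sums over one
  and the same index set and can be interchanged.\<close>

lemma mat_mult_assoc:
  assumes a: "a \<in> local_matrices w m" and b: "b \<in> local_matrices w l"
  shows "mat_mult (mat_mult a b) c = mat_mult a (mat_mult b c)"
proof (rule entry_eqI)
  fix i j
  define S where "S = {i - int (m + l)..i + int (m + l)}"
  have "entry (mat_mult (mat_mult a b) c) i j = (\<Sum>k\<in>S. entry (mat_mult a b) i k * entry c k j)"
    by (rule entry_mat_mult) (use local_matrices_row[OF local_matrices_mat_mult[OF a b], of _ i] in \<open>auto simp: S_def\<close>)
  also have "\<dots> = (\<Sum>k\<in>S. (\<Sum>h\<in>S. entry a i h * entry b h k) * entry c k j)"
    by (intro sum.cong refl arg_cong2[where f = "(*)"] entry_mat_mult)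
       (use local_matrices_row[OF a, of _ i] in \<open>auto simp: S_def\<close>)
  also have "\<dots> = (\<Sum>h\<in>S. \<Sum>k\<in>S. entry a i h * (entry b h k * entry c k j))"
    unfolding sum_distrib_right by (subst sum.swap) (simp add: mult.assoc)
  also have "\<dots> = (\<Sum>h\<in>S. entry a i h * entry (mat_mult b c) h j)"
  proof (rule sum.cong)
    fix h assume "h \<in> S"
    show "(\<Sum>k\<in>S. entry a i h * (entry b h k * entry c k j)) = entry a i h * entry (mat_mult b c) h j"
    proof (cases "entry a i h = 0")
      case False
      then have h: "\<bar>h - i\<bar> \<le> int m" using local_matrices_band[OF a] not_le by blast
      have "entry (mat_mult b c) h j = (\<Sum>k\<in>S. entry b h k * entry c k j)"
        by (rule entry_mat_mult) (use h in \<open>auto simp: S_def intro!: local_matrices_band[OF b]\<close>)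
      then show ?thesis by (simp add: sum_distrib_left)
    qed simp
  qed simp
  also have "\<dots> = entry (mat_mult a (mat_mult b c)) i j"
    by (rule entry_mat_mult[symmetric]) (use local_matrices_row[OF a, of _ i] in \<open>auto simp: S_def\<close>)
  finally show "entry (mat_mult (mat_mult a b) c) i j = entry (mat_mult a (mat_mult b c)) i j" .
qed

lemma mat_mult_add_left:
  assumes a: "a \<in> local_matrices w m" and b: "b \<in> local_matrices w m"
  shows "mat_mult (a + b) c = mat_mult a c + mat_mult b c"
  by (rule entry_eqI)
    (simp add: entry_mat_mult_local[OF a] entry_mat_mult_local[OF b] entry_mat_mult_local[OF fv.subspace_add[OF local_matrices_subspace a b]]
      ring_distribs sum.distrib)

lemma mat_mult_add_right: "a \<in> local_matrices w m \<Longrightarrow> mat_mult a (b + c) = mat_mult a b + mat_mult a c"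
  by (rule entry_eqI) (simp add: entry_mat_mult_local ring_distribs sum.distrib)

lemma mat_mult_scale_left: "a \<in> local_matrices w m \<Longrightarrow> mat_mult (scale r a) b = scale r (mat_mult a b)"
  by (rule entry_eqI) (simp add: entry_mat_mult_local[OF fv.subspace_scale[OF local_matrices_subspace]] entry_mat_mult_local sum_distrib_left mult.assoc)

lemma mat_mult_scale_right: "a \<in> local_matrices w m \<Longrightarrow> mat_mult a (scale r b) = scale r (mat_mult a b)"
  by (rule entry_eqI) (simp add: entry_mat_mult_local sum_distrib_left mult.left_commute)

text \<open>The characteristic function of a cylinder set times a power of the shift: the entries equal to \<open>1\<close>
  are on the diagonal \<open>d\<close>, in the rows \<open>i\<close> for which \<open>u\<close> occurs at \<open>i + s\<close>.  The empty word gives the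
  powers of the shift, and the identity for \<open>d = 0\<close>.\<close>

definition cylinder :: "(int \<Rightarrow> 'b) \<Rightarrow> int \<Rightarrow> 'b list \<Rightarrow> int \<Rightarrow> nat \<Rightarrow> 'k::field" where
  "cylinder w s u d = of_entries (\<lambda>i j. if j = i + d \<and> window w (i + s) (length u) = u then 1 else 0)"

lemma entry_cylinder [simp]:
  "entry (cylinder w s u d) i j = (if j = i + d \<and> window w (i + s) (length u) = u then 1 else 0)"
  by (simp add: cylinder_def)

lemma cylinder_local:
  assumes "\<bar>s\<bar> + int (length u) \<le> int m" "\<bar>d\<bar> \<le> int m"
  shows "cylinder w s u d \<in> local_matrices w m"
proof (rule local_matricesI)
  show "entry (cylinder w s u d) i j = 0" if "int m < \<bar>j - i\<bar>" for i j
    using that assms(2) by auto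
  show "entry (cylinder w s u d) i (i + e) = entry (cylinder w s u d) i' (i' + e)" if "agree w m i i'" for i i' e
  proof -
    have "window w (i + s) (length u) = window w (i' + s) (length u)"
      unfolding window_eq_iff
    proof (intro allI impI)
      fix t assume "t < length u"
      then have "\<bar>s + int t\<bar> \<le> int m" using assms(1) by linarith
      then show "w (i + s + int t) = w (i' + s + int t)" using that unfolding agree_def
        by (metis add.assoc)
    qed
    then show ?thesis by simp
  qed
qed

lemma cylinder_in_local: "\<exists>m. cylinder w s u d \<in> local_matrices w m"
  by (rule exI[of _ "nat (\<bar>s\<bar> + int (length u) + \<bar>d\<bar>)"], rule cylinder_local) auto

lemma entry_cylinder_mat_mult:
  "entry (mat_mult (cylinder w s u d) b) i j = (if window w (i + s) (length u) = u then entry b (i + d) j else 0)"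
  by (subst entry_mat_mult[where S = "{i + d}"]) auto

lemma entry_mat_mult_shift:
  assumes "a \<in> local_matrices w m"
  shows "entry (mat_mult a (cylinder w 0 [] e)) i j = entry a i (j - e)"
proof -
  have "entry (mat_mult a (cylinder w 0 [] e)) i j = (\<Sum>k\<in>insert (j - e) {i - int m..i + int m}. entry a i k * entry (cylinder w 0 [] e) k j)"
    by (rule entry_mat_mult) (use local_matrices_row[OF assms, of _ i] in auto)
  also have "\<dots> = (\<Sum>k\<in>{j - e}. entry a i k * entry (cylinder w 0 [] e) k j)"
    by (rule sum.mono_neutral_right) auto
  finally show ?thesis by simp
qed

lemma cylinder_shift_left: "mat_mult (cylinder w 0 [] e) (cylinder w s u d) = cylinder w (s + e) u (d + e)"
  by (rule entry_eqI) (auto simp: entry_cylinder_mat_mult algebra_simps)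

lemma cylinder_shift_right: "mat_mult (cylinder w s u d) (cylinder w 0 [] e) = cylinder w s u (d + e)"
  by (rule entry_eqI) (auto simp: entry_cylinder_mat_mult algebra_simps)

lemma window_Cons: "window w i (Suc n) = w i # window w (i + 1) n"
  using window_add[of w i 1 n] by (simp add: window_def)

lemma cylinder_Cons: "mat_mult (cylinder w 0 [x] 0) (cylinder w 1 u d) = cylinder w 0 (x # u) d"
  by (rule entry_eqI) (auto simp: entry_cylinder_mat_mult window_Cons)

lemma cylinder_Cons_shift: "mat_mult (cylinder w 0 [x] 1) (cylinder w 0 u d) = cylinder w 0 (x # u) (d + 1)"
  by (rule entry_eqI) (auto simp: entry_cylinder_mat_mult window_Cons algebra_simps)

lemma mat_mult_one_left: "mat_mult (cylinder w 0 [] 0) b = b"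
  by (rule entry_eqI) (simp add: entry_cylinder_mat_mult)

lemma mat_mult_one_right: "a \<in> local_matrices w m \<Longrightarrow> mat_mult a (cylinder w 0 [] 0) = a"
  by (rule entry_eqI) (simp add: entry_mat_mult_shift)

definition word_algebra :: "(int \<Rightarrow> 'b) \<Rightarrow> ('k::field, nat \<Rightarrow> 'k) module" where
  "word_algebra w = \<lparr>carrier = (\<Union>m. local_matrices w m), monoid.mult = mat_mult, one = cylinder w 0 [] 0,
     zero = 0, add = (+), module.smult = scale\<rparr>"

lemma word_algebra_simps [simp]:
  "carrier (word_algebra w) = (\<Union>m. local_matrices w m)"
  "monoid.mult (word_algebra w) = mat_mult"
  "one (word_algebra w) = cylinder w 0 [] 0"
  "zero (word_algebra w) = 0"
  "add (word_algebra w) = (+)"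
  "module.smult (word_algebra w) = scale"
  by (simp_all add: word_algebra_def)

abbreviation scalars :: "'k::field ring" where
  "scalars \<equiv> ring_of_type_algebra"

lemma scalars_simps [simp]:
  "carrier scalars = UNIV"
  "monoid.mult scalars = (*)" "one scalars = 1" "zero scalars = 0" "add scalars = (+)"
  by (simp_all add: ring_of_type_algebra_def)

lemma common_level:
  assumes "finite B" "B \<subseteq> (\<Union>m. local_matrices w m)"
  shows "\<exists>m. B \<subseteq> local_matrices w m"
  using assms
proof (induction B rule: finite_induct)
  case (insert x B)
  then obtain m n where "B \<subseteq> local_matrices w m" "x \<in> local_matrices w n" by auto
  then have "insert x B \<subseteq> local_matrices w (max m n)" using local_matrices_mono[of m "max m n" w] local_matrices_mono[of n "max m n" w] by auto
  then show ?case by blast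
qed simp

lemma common_level2:
  fixes a b :: "nat \<Rightarrow> 'k::field"
  assumes "a \<in> (\<Union>m. local_matrices w m)" "b \<in> (\<Union>m. local_matrices w m)"
  obtains m where "a \<in> local_matrices w m" "b \<in> local_matrices w m"
  using common_level[of "{a, b}" w] assms by auto

lemma carrier_subspace: "fv.subspace (\<Union>m. local_matrices w m)"
proof (rule fv.subspaceI)
  show "0 \<in> (\<Union>m. local_matrices w m)" using fv.subspace_0[OF local_matrices_subspace] by blast
  show "a + b \<in> (\<Union>m. local_matrices w m)" if "a \<in> (\<Union>m. local_matrices w m)" "b \<in> (\<Union>m. local_matrices w m)" for a b
    using common_level2[OF that] fv.subspace_add[OF local_matrices_subspace] by (metis UNIV_I UN_I)
  show "scale c a \<in> (\<Union>m. local_matrices w m)" if "a \<in> (\<Union>m. local_matrices w m)" for c a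
    using that fv.subspace_scale[OF local_matrices_subspace] by blast
qed

lemma word_algebra_ring: "ring (word_algebra w :: ('k::field, nat \<Rightarrow> 'k) module)"
proof (rule ringI)
  let ?A = "word_algebra w :: ('k, nat \<Rightarrow> 'k) module"
  note C = carrier_subspace[of w]
  show "abelian_group ?A"
  proof (rule abelian_groupI)
    show "\<exists>b\<in>carrier ?A. b \<oplus>\<^bsub>?A\<^esub> a = \<zero>\<^bsub>?A\<^esub>" if "a \<in> carrier ?A" for a
      using that fv.subspace_neg[OF C] by (intro bexI[of _ "- a"]) auto
  qed (use fv.subspace_add[OF C] fv.subspace_0[OF C] in \<open>simp_all add: add.assoc add.commute\<close>)
  show "monoid ?A"
  proof (rule monoidI)
    fix a b c assume a: "a \<in> carrier ?A" and b: "b \<in> carrier ?A"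
    then show "a \<otimes>\<^bsub>?A\<^esub> b \<in> carrier ?A" using local_matrices_mat_mult by fastforce
    show "a \<otimes>\<^bsub>?A\<^esub> b \<otimes>\<^bsub>?A\<^esub> c = a \<otimes>\<^bsub>?A\<^esub> (b \<otimes>\<^bsub>?A\<^esub> c)"
      using a b mat_mult_assoc by fastforce
    show "a \<otimes>\<^bsub>?A\<^esub> \<one>\<^bsub>?A\<^esub> = a" using a mat_mult_one_right by fastforce
    show "\<one>\<^bsub>?A\<^esub> \<otimes>\<^bsub>?A\<^esub> a = a" by (simp add: mat_mult_one_left)
  next
    show "\<one>\<^bsub>?A\<^esub> \<in> carrier ?A" using cylinder_in_local by simp
  qed
  fix a b c assume abc: "a \<in> carrier ?A" "b \<in> carrier ?A" "c \<in> carrier ?A"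
  then obtain m where "a \<in> local_matrices w m" "b \<in> local_matrices w m" using common_level2[of a w b] by auto
  then show "(a \<oplus>\<^bsub>?A\<^esub> b) \<otimes>\<^bsub>?A\<^esub> c = a \<otimes>\<^bsub>?A\<^esub> c \<oplus>\<^bsub>?A\<^esub> b \<otimes>\<^bsub>?A\<^esub> c"
    by (simp add: mat_mult_add_left)
  show "c \<otimes>\<^bsub>?A\<^esub> (a \<oplus>\<^bsub>?A\<^esub> b) = c \<otimes>\<^bsub>?A\<^esub> a \<oplus>\<^bsub>?A\<^esub> c \<otimes>\<^bsub>?A\<^esub> b"
    using abc(3) mat_mult_add_right by fastforce
qed

lemma word_algebra_module: "module scalars (word_algebra w :: ('k::field, nat \<Rightarrow> 'k) module)"
proof -
  interpret ring "word_algebra w :: ('k, nat \<Rightarrow> 'k) module" by (rule word_algebra_ring)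
  show ?thesis
  proof (rule moduleI)
    show "cring (scalars :: 'k ring)" by (rule cring_from_type_algebra)
    show "abelian_group (word_algebra w :: ('k, nat \<Rightarrow> 'k) module)" by (rule is_abelian_group)
  qed (use fv.subspace_scale[OF carrier_subspace] in
      \<open>simp_all add: fv.scale_left_distrib fv.scale_right_distrib\<close>)
qed

lemma word_algebra_assoc_algebra:
  "assoc_algebra scalars (word_algebra w :: ('k::field, nat \<Rightarrow> 'k) module)"
proof (intro assoc_algebra.intro assoc_algebra_axioms.intro word_algebra_module word_algebra_ring)
qed (use mat_mult_scale_left mat_mult_scale_right in fastforce)+

section \<open>Span, dimension and growth in the algebra of a word\<close>

text \<open>The matrices form a vector space as a whole type.  Submodules of the algebra are subspaces of this
  space, so span and dimension reduce to the notions for vector spaces on types.\<close>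

lemma word_algebra_submodule_iff:
  "submodule N scalars (word_algebra w :: ('k::field, nat \<Rightarrow> 'k) module)
     \<longleftrightarrow> fv.subspace N \<and> N \<subseteq> (\<Union>m. local_matrices w m)"
proof
  let ?A = "word_algebra w :: ('k, nat \<Rightarrow> 'k) module"
  interpret module scalars ?A by (rule word_algebra_module)
  {
    assume N: "submodule N scalars ?A"
    then interpret N: submodule N scalars ?A .
    have "fv.subspace N"
      using N.one_closed N.m_closed submoduleE(4)[OF N]
      by (intro fv.subspaceI) simp_all
    then show "fv.subspace N \<and> N \<subseteq> (\<Union>m. local_matrices w m)"
      using submoduleE(1)[OF N] by simp
  }
  assume N: "fv.subspace N \<and> N \<subseteq> (\<Union>m. local_matrices w m)"
  then have sub: "fv.subspace N" and le: "N \<subseteq> carrier ?A" by simp_all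
  show "submodule N scalars ?A"
  proof (rule submoduleI)
    fix a assume a: "a \<in> N"
    then have neg: "- a \<in> N" by (rule fv.subspace_neg[OF sub])
    have "\<ominus>\<^bsub>?A\<^esub> a = - a"
      using a neg le by (intro minus_equality) auto
    then show "\<ominus>\<^bsub>?A\<^esub> a \<in> N" using neg by simp
  qed (use le fv.subspace_0[OF sub] fv.subspace_add[OF sub] fv.subspace_scale[OF sub] in auto)
qed

lemma word_algebra_lin_span:
  fixes S :: "(nat \<Rightarrow> 'k::field) set"
  assumes "S \<subseteq> (\<Union>m. local_matrices w m)"
  shows "lin_span scalars (word_algebra w) S = fv.span S"
proof -
  have "fv.span S \<subseteq> (\<Union>m. local_matrices w m)" by (rule fv.span_minimal[OF assms carrier_subspace])
  then have "fv.span S \<in> {N. submodule N scalars (word_algebra w) \<and> S \<subseteq> N}"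
    by (simp add: word_algebra_submodule_iff fv.span_superset)
  moreover have "fv.span S \<subseteq> N" if "N \<in> {N. submodule N scalars (word_algebra w) \<and> S \<subseteq> N}" for N
    using that word_algebra_submodule_iff[of N w] by (intro fv.span_minimal) auto
  ultimately show ?thesis unfolding lin_span_def by blast
qed

lemma word_algebra_lin_dim:
  fixes S :: "(nat \<Rightarrow> 'k::field) set"
  assumes S: "S \<subseteq> (\<Union>m. local_matrices w m)" "fv.subspace S"
  shows "lin_dim scalars (word_algebra w) S = fv.dim S"
proof -
  let ?A = "word_algebra w :: ('k, nat \<Rightarrow> 'k) module"
  define Q where "Q B \<longleftrightarrow> B \<subseteq> S \<and> lin_independent scalars ?A B \<and> lin_span scalars ?A B = S" for B
  have Q: "Q B \<longleftrightarrow> B \<subseteq> S \<and> fv.independent B \<and> fv.span B = S" for B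
  proof (cases "B \<subseteq> S")
    case True
    then have sub: "B \<subseteq> (\<Union>m. local_matrices w m)" "B - {b} \<subseteq> (\<Union>m. local_matrices w m)" for b
      using S(1) by blast+
    show ?thesis
      unfolding Q_def lin_independent_def fv.dependent_def
        word_algebra_lin_span[OF sub(1)] word_algebra_lin_span[OF sub(2)] by blast
  next
    case False
    then show ?thesis unfolding Q_def by blast
  qed
  have "\<exists>B. Q B"
  proof -
    obtain B where "B \<subseteq> S" "fv.independent B" "S \<subseteq> fv.span B" by (rule fv.basis_exists)
    then show ?thesis unfolding Q using fv.span_minimal[OF _ S(2), of B] by blast
  qed
  then have "Q (SOME B. Q B)" by (rule someI_ex)
  then have "card (SOME B. Q B) = fv.dim S"
    using Q[of "SOME B. Q B"] by (intro fv.basis_card_eq_dim) blast+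
  then show ?thesis unfolding lin_dim_def Q_def .
qed

lemma card_independent_le_dim:
  assumes "W \<subseteq> fv.span T" "finite T" "S \<subseteq> fv.span W" "fv.independent S"
  shows "card S \<le> fv.dim W"
proof -
  obtain B where B: "B \<subseteq> W" "fv.independent B" "W \<subseteq> fv.span B" "card B = fv.dim W"
    by (rule fv.basis_exists)
  have "finite B" using fv.independent_span_bound[OF assms(2) B(2)] B(1) assms(1) by blast
  moreover have "S \<subseteq> fv.span B" using assms(3) B(3) fv.span_minimal[OF B(3) fv.subspace_span] by blast
  ultimately have "card S \<le> card B" using fv.independent_span_bound assms(4) by blast
  then show ?thesis using B(4) by simp
qed

definition products :: "(int \<Rightarrow> 'b) \<Rightarrow> (nat \<Rightarrow> 'k::field) set \<Rightarrow> nat \<Rightarrow> (nat \<Rightarrow> 'k) set" where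
  "products w V n = {foldr mat_mult xs (cylinder w 0 [] 0) | xs. set xs \<subseteq> V \<and> length xs \<le> n}"

lemma foldr_local:
  assumes "set xs \<subseteq> local_matrices w m"
  shows "foldr mat_mult xs (cylinder w 0 [] 0) \<in> local_matrices w (m * length xs)"
  using assms
proof (induction xs)
  case Nil
  then show ?case by (simp add: cylinder_local)
next
  case (Cons x xs)
  then show ?case using local_matrices_mat_mult[of x w m] by simp
qed

lemma products_subset_local:
  assumes "V \<subseteq> local_matrices w m"
  shows "products w V n \<subseteq> local_matrices w (m * n)"
proof
  fix a assume "a \<in> products w V n"
  then obtain xs where xs: "set xs \<subseteq> V" "length xs \<le> n" "a = foldr mat_mult xs (cylinder w 0 [] 0)"
    by (auto simp: products_def)
  then have "a \<in> local_matrices w (m * length xs)" using foldr_local assms by blast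
  moreover have "local_matrices w (m * length xs) \<subseteq> local_matrices w (m * n)" using xs(2) by (intro local_matrices_mono) simp
  ultimately show "a \<in> local_matrices w (m * n)" by blast
qed

lemma foldr_carrier:
  assumes "set xs \<subseteq> (\<Union>m. local_matrices w m)"
  shows "foldr mat_mult xs (cylinder w 0 [] 0) \<in> (\<Union>m. local_matrices w m)"
  using common_level[OF finite_set assms] foldr_local by blast

lemma foldr_mat_mult_append:
  assumes "set xs \<subseteq> (\<Union>m. local_matrices w m)"
  shows "foldr mat_mult (xs @ ys) (cylinder w 0 [] 0)
       = mat_mult (foldr mat_mult xs (cylinder w 0 [] 0)) (foldr mat_mult ys (cylinder w 0 [] 0))"
  using assms
proof (induction xs)
  case (Cons x xs)
  obtain m where m: "x \<in> local_matrices w m" using Cons.prems by auto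
  obtain l where l: "foldr mat_mult xs (cylinder w 0 [] 0) \<in> local_matrices w l" using foldr_carrier[of xs w] Cons.prems by auto
  show ?case using Cons mat_mult_assoc[OF m l] by simp
qed (simp add: mat_mult_one_left)

text \<open>Bilinearity, used in one argument at a time.  The subspaces for the induction are cut down to the
  carrier since multiplication is bilinear only on matrices with finitely supported rows.\<close>

lemma mat_mult_span:
  assumes carrier: "S \<subseteq> (\<Union>m. local_matrices w m)" "T \<subseteq> (\<Union>m. local_matrices w m)"
    and sub: "fv.subspace Z" and prod: "\<And>a b. a \<in> S \<Longrightarrow> b \<in> T \<Longrightarrow> mat_mult a b \<in> Z"
    and x: "x \<in> fv.span S" and y: "y \<in> fv.span T"
  shows "mat_mult x y \<in> Z"
proof -
  have y': "mat_mult a y \<in> Z" if a: "a \<in> S" for a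
  proof -
    obtain m where m: "a \<in> local_matrices w m" using a carrier by blast
    have "fv.subspace {b. mat_mult a b \<in> Z}"
    proof (rule fv.subspaceI)
      have "mat_mult a 0 = 0" by (rule entry_eqI) (simp add: entry_mat_mult_local[OF m])
      then show "0 \<in> {b. mat_mult a b \<in> Z}" using fv.subspace_0[OF sub] by simp
    qed (simp_all add: mat_mult_add_right[OF m] mat_mult_scale_right[OF m] fv.subspace_add[OF sub] fv.subspace_scale[OF sub])
    then have "fv.span T \<subseteq> {b. mat_mult a b \<in> Z}" using prod a by (intro fv.span_minimal) auto
    then show ?thesis using y by blast
  qed
  have "fv.subspace {a \<in> (\<Union>m. local_matrices w m). mat_mult a y \<in> Z}"
  proof (rule fv.subspaceI)
    have "mat_mult 0 y = 0" by (rule entry_eqI) (simp add: entry_mat_mult[where S = "{}"])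
    then show "0 \<in> {a \<in> (\<Union>m. local_matrices w m). mat_mult a y \<in> Z}"
      using fv.subspace_0[OF sub] fv.subspace_0[OF carrier_subspace] by simp
  next
    fix a b assume ab: "a \<in> {a \<in> (\<Union>m. local_matrices w m). mat_mult a y \<in> Z}" "b \<in> {a \<in> (\<Union>m. local_matrices w m). mat_mult a y \<in> Z}"
    then obtain m where "a \<in> local_matrices w m" "b \<in> local_matrices w m" using common_level2[of a w b] by auto
    then have "mat_mult (a + b) y = mat_mult a y + mat_mult b y" by (rule mat_mult_add_left)
    then show "a + b \<in> {a \<in> (\<Union>m. local_matrices w m). mat_mult a y \<in> Z}"
      using ab fv.subspace_add[OF sub] fv.subspace_add[OF carrier_subspace, of a w b] by simp
  next
    fix c a assume a: "a \<in> {a \<in> (\<Union>m. local_matrices w m). mat_mult a y \<in> Z}"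
    then obtain m where "a \<in> local_matrices w m" by blast
    then have "mat_mult (scale c a) y = scale c (mat_mult a y)" by (rule mat_mult_scale_left)
    then show "scale c a \<in> {a \<in> (\<Union>m. local_matrices w m). mat_mult a y \<in> Z}"
      using a fv.subspace_scale[OF sub] fv.subspace_scale[OF carrier_subspace, of a w c] by simp
  qed
  then have "fv.span S \<subseteq> {a \<in> (\<Union>m. local_matrices w m). mat_mult a y \<in> Z}"
    using carrier y' by (intro fv.span_minimal) auto
  then show ?thesis using x by blast
qed

lemma products_carrier:
  assumes "V \<subseteq> (\<Union>m. local_matrices w m)"
  shows "products w V n \<subseteq> (\<Union>m. local_matrices w m)"
  unfolding products_def using foldr_carrier assms by blast

lemma products_mat_mult:
  assumes V: "V \<subseteq> (\<Union>m. local_matrices w m)"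
    and "x \<in> fv.span (products w V n)" "y \<in> fv.span (products w V m)"
  shows "mat_mult x y \<in> fv.span (products w V (n + m))"
proof (rule mat_mult_span[OF products_carrier[OF V] products_carrier[OF V] fv.subspace_span _ assms(2,3)])
  fix a b assume "a \<in> products w V n" "b \<in> products w V m"
  then obtain xs ys where xs: "set xs \<subseteq> V" "length xs \<le> n" "a = foldr mat_mult xs (cylinder w 0 [] 0)"
    and ys: "set ys \<subseteq> V" "length ys \<le> m" "b = foldr mat_mult ys (cylinder w 0 [] 0)"
    unfolding products_def by blast
  have "mat_mult a b = foldr mat_mult (xs @ ys) (cylinder w 0 [] 0)"
    using foldr_mat_mult_append[of xs w ys] xs ys V by auto
  then have "mat_mult a b \<in> products w V (n + m)"
    unfolding products_def using xs ys by (intro CollectI exI[of _ "xs @ ys"]) auto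
  then show "mat_mult a b \<in> fv.span (products w V (n + m))" by (rule fv.span_base)
qed

lemma products_mono: "m \<le> n \<Longrightarrow> products w V m \<subseteq> products w V n"
  unfolding products_def by force

lemma growth_function_eq:
  fixes V :: "(nat \<Rightarrow> 'k::field) set"
  assumes "V \<subseteq> (\<Union>m. local_matrices w m)"
  shows "growth_function scalars (word_algebra w) V n = fv.dim (products w V n)"
proof -
  have "power_le scalars (word_algebra w) V n = fv.span (products w V n)"
    unfolding power_le_def using word_algebra_lin_span[OF products_carrier[OF assms]]
    by (simp add: products_def)
  moreover have "fv.span (products w V n) \<subseteq> (\<Union>m. local_matrices w m)"
    by (rule fv.span_minimal[OF products_carrier[OF assms] carrier_subspace])
  ultimately show ?thesis
    unfolding growth_function_def using word_algebra_lin_dim fv.subspace_span by (metis fv.dim_span)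
qed

lemma generating_subspace_carrier:
  assumes "generating_subspace scalars (word_algebra w :: ('k::field, nat \<Rightarrow> 'k) module) V"
  shows "V \<subseteq> (\<Union>m. local_matrices w m)"
  using assms unfolding generating_subspace_def word_algebra_submodule_iff by blast

lemma generating_subspace_level:
  assumes "generating_subspace scalars (word_algebra w :: ('k::field, nat \<Rightarrow> 'k) module) V"
  shows "\<exists>m. V \<subseteq> local_matrices w m"
proof -
  have V: "V \<subseteq> (\<Union>m. local_matrices w m)" by (rule generating_subspace_carrier[OF assms])
  obtain S where S: "finite S" "S \<subseteq> V" "lin_span scalars (word_algebra w) S = V"
    using assms unfolding generating_subspace_def by blast
  then have S': "S \<subseteq> (\<Union>m. local_matrices w m)" using V by blast
  then obtain m where "S \<subseteq> local_matrices w m" using common_level S by blast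
  then have "fv.span S \<subseteq> local_matrices w m" by (rule fv.span_minimal[OF _ local_matrices_subspace])
  then show ?thesis using S(3) word_algebra_lin_span[OF S'] by blast
qed

text \<open>The union of the filtration by products is a subalgebra that contains \<open>V\<close>.\<close>

lemma generating_subspace_exhausts:
  assumes gen: "generating_subspace scalars (word_algebra w :: ('k::field, nat \<Rightarrow> 'k) module) V"
    and a: "a \<in> (\<Union>m. local_matrices w m)"
  shows "\<exists>d. a \<in> fv.span (products w V d)"
proof -
  let ?A = "word_algebra w :: ('k, nat \<Rightarrow> 'k) module"
  define B where "B = (\<Union>n. fv.span (products w V n))"
  have V: "V \<subseteq> (\<Union>m. local_matrices w m)" by (rule generating_subspace_carrier[OF gen])
  have mono: "fv.span (products w V m) \<subseteq> fv.span (products w V n)" if "m \<le> n" for m n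
    by (rule fv.span_mono[OF products_mono[OF that]])
  have BI: "x \<in> B" if "x \<in> fv.span (products w V n)" for x n using that unfolding B_def by blast
  have two: "\<exists>n. x \<in> fv.span (products w V n) \<and> y \<in> fv.span (products w V n)"
    if xy: "x \<in> B" "y \<in> B" for x y
  proof -
    obtain m n where "x \<in> fv.span (products w V m)" "y \<in> fv.span (products w V n)" using xy unfolding B_def by blast
    then have "x \<in> fv.span (products w V (max m n))" "y \<in> fv.span (products w V (max m n))"
      using mono[of m "max m n"] mono[of n "max m n"] by auto
    then show ?thesis by blast
  qed
  have one: "cylinder w 0 [] 0 \<in> B"
    by (rule BI[of _ 0], rule fv.span_base) (simp add: products_def)
  have Bsub: "fv.subspace B"
  proof (rule fv.subspaceI)
    show "0 \<in> B" by (rule BI[of _ 0]) (rule fv.span_zero)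
    show "x + y \<in> B" if "x \<in> B" "y \<in> B" for x y
      using two[OF that] fv.span_add BI by blast
    show "scale c x \<in> B" if "x \<in> B" for c x
      using two[OF that that] fv.span_scale BI by blast
  qed
  have BE: "B \<subseteq> (\<Union>m. local_matrices w m)"
    unfolding B_def using fv.span_minimal[OF products_carrier[OF V] carrier_subspace] by blast
  have "submodule B scalars ?A" using word_algebra_submodule_iff Bsub BE by blast
  moreover have "subring B ?A"
  proof -
    interpret ring ?A by (rule word_algebra_ring)
    interpret M: module scalars ?A by (rule word_algebra_module)
    have "mat_mult x y \<in> B" if "x \<in> B" "y \<in> B" for x y
      using two[OF that] products_mat_mult[OF V] BI by blast
    then show ?thesis
      using M.submoduleE[OF \<open>submodule B scalars ?A\<close>] one BE
      by (intro subringI) auto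
  qed
  moreover have "V \<subseteq> B"
  proof
    fix v assume v: "v \<in> V"
    then obtain m where "v \<in> local_matrices w m" using V by blast
    then have "v = foldr mat_mult [v] (cylinder w 0 [] 0)" by (simp add: mat_mult_one_right)
    then have "v \<in> products w V 1" unfolding products_def using v by (intro CollectI exI[of _ "[v]"]) simp
    then show "v \<in> B" using BI fv.span_base by blast
  qed
  ultimately have "B = carrier ?A" using gen unfolding generating_subspace_def by blast
  then show ?thesis using a B_def by auto
qed

section \<open>Growth and complexity\<close>

definition monomials :: "(int \<Rightarrow> 'b) \<Rightarrow> nat \<Rightarrow> (nat \<Rightarrow> 'k::field) set" where
  "monomials w m = (\<lambda>(u, d). cylinder w (- int m) u d) `
     (range (\<lambda>i. window w i (2 * m + 1)) \<times> {- int m..int m})"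

text \<open>A matrix of radius \<open>m\<close> is constant on the rows that see one window \<open>u\<close>, on each diagonal \<open>d\<close>.  Its
  coefficient at the monomial of \<open>(u, d)\<close> is this constant, read off in a representative row \<open>i0 u\<close>.\<close>

lemma local_matrices_subset_span_monomials:
  fixes w :: "int \<Rightarrow> 'b"
  assumes fin: "finite (range (\<lambda>i. window w i (2 * m + 1)))"
  shows "(local_matrices w m :: (nat \<Rightarrow> 'k::field) set) \<subseteq> fv.span (monomials w m)"
proof
  fix a :: "nat \<Rightarrow> 'k" assume a: "a \<in> local_matrices w m"
  define L where "L = range (\<lambda>i. window w i (2 * m + 1))"
  define J where "J = L \<times> {- int m..int m}"
  define i0 where "i0 u = (SOME i. window w (i - int m) (2 * m + 1) = u)" for u
  have finJ: "finite J" using fin unfolding J_def L_def by simp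
  have i0: "agree w m (i0 (window w (i - int m) (2 * m + 1))) i" for i
    unfolding agree_window i0_def by (rule someI) (rule refl)
  have "a = (\<Sum>(u, d)\<in>J. scale (entry a (i0 u) (i0 u + d)) (cylinder w (- int m) u d))"
  proof (rule entry_eqI)
    fix i j
    define u where "u = window w (i - int m) (2 * m + 1)"
    have "u = window w (i - int m) (length u)" by (simp add: u_def)
    have entry_term: "entry (scale (entry a (i0 v) (i0 v + d)) (cylinder w (- int m) v d)) i j
        = (if (v, d) = (u, j - i) then entry a i j else 0)" if "(v, d) \<in> J" for v d
    proof -
      have "length v = 2 * m + 1" using that unfolding J_def L_def by auto
      then have "window w (i + - int m) (length v) = v \<longleftrightarrow> v = u" unfolding u_def by auto
      moreover have "entry a (i0 u) (i0 u + (j - i)) = entry a i (i + (j - i))"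
        unfolding u_def by (rule local_matrices_local[OF a i0])
      ultimately show ?thesis by auto
    qed
    have "entry (\<Sum>(u, d)\<in>J. scale (entry a (i0 u) (i0 u + d)) (cylinder w (- int m) u d)) i j
        = (\<Sum>p\<in>J. if p = (u, j - i) then entry a i j else 0)"
      unfolding entry_sum
    proof (rule sum.cong)
      fix p assume p: "p \<in> J"
      obtain v d where p_eq: "p = (v, d)" by (cases p)
      show "entry (case p of (u, d) \<Rightarrow> scale (entry a (i0 u) (i0 u + d)) (cylinder w (- int m) u d)) i j
          = (if p = (u, j - i) then entry a i j else 0)"
        using entry_term p unfolding p_eq prod.case by blast
    qed (rule refl)
    also have "\<dots> = (if (u, j - i) \<in> J then entry a i j else 0)" using finJ by simp
    also have "\<dots> = entry a i j"
    proof (cases "(u, j - i) \<in> J")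
      case False
      moreover have "u \<in> L" unfolding u_def L_def by blast
      ultimately have "j - i \<notin> {- int m..int m}" unfolding J_def by blast
      then have "int m < \<bar>j - i\<bar>" unfolding atLeastAtMost_iff by linarith
      then show ?thesis using local_matrices_band[OF a] by simp
    qed simp
    finally show "entry a i j = entry (\<Sum>(u, d)\<in>J. scale (entry a (i0 u) (i0 u + d)) (cylinder w (- int m) u d)) i j" ..
  qed
  moreover have "(case p of (u, d) \<Rightarrow> scale (entry a (i0 u) (i0 u + d)) (cylinder w (- int m) u d)) \<in> fv.span (monomials w m)"
    if "p \<in> J" for p
  proof -
    have "(case p of (u, d) \<Rightarrow> cylinder w (- int m) u d) \<in> (monomials w m :: (nat \<Rightarrow> 'k) set)"
      unfolding monomials_def using that unfolding J_def L_def by (rule imageI)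
    then show ?thesis by (cases p) (simp add: fv.span_scale fv.span_base)
  qed
  then have "(\<Sum>(u, d)\<in>J. scale (entry a (i0 u) (i0 u + d)) (cylinder w (- int m) u d)) \<in> fv.span (monomials w m)"
    by (rule fv.span_sum)
  ultimately show "a \<in> fv.span (monomials w m)" by simp
qed

lemma card_monomials:
  assumes "finite (range (\<lambda>i. window w i (2 * m + 1)))"
  shows "finite (monomials w m)" "card (monomials w m) \<le> (2 * m + 1) * complexity w (2 * m + 1)"
proof -
  show "finite (monomials w m)" unfolding monomials_def using assms by simp
  have "card (monomials w m) \<le> card (range (\<lambda>i. window w i (2 * m + 1)) \<times> {- int m..int m})"
    unfolding monomials_def by (rule card_image_le) (use assms in simp)
  also have "\<dots> = complexity w (2 * m + 1) * (2 * m + 1)"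
  proof -
    have "card {- int m..int m} = 2 * m + 1" by simp
    then show ?thesis unfolding card_cartesian_product complexity_def by (simp only:)
  qed
  finally show "card (monomials w m) \<le> (2 * m + 1) * complexity w (2 * m + 1)" by (simp only: mult.commute)
qed

lemma growth_upper:
  assumes fin: "\<And>n. finite (range (\<lambda>i. window w i n))"
    and gen: "generating_subspace scalars (word_algebra w :: ('k::field, nat \<Rightarrow> 'k) module) V"
  shows "\<exists>m\<ge>1. \<forall>n. growth_function scalars (word_algebra w) V n
                    \<le> (2 * (m * n) + 1) * complexity w (2 * (m * n) + 1)"
proof -
  obtain m0 where m0: "V \<subseteq> local_matrices w m0" using generating_subspace_level[OF gen] by blast
  define m where "m = max 1 m0"
  have m: "V \<subseteq> local_matrices w m" using m0 local_matrices_mono[of m0 m w] unfolding m_def by auto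
  have "growth_function scalars (word_algebra w) V n
      \<le> (2 * (m * n) + 1) * complexity w (2 * (m * n) + 1)" for n
  proof -
    have "products w V n \<subseteq> fv.span (monomials w (m * n))"
      using products_subset_local[OF m] local_matrices_subset_span_monomials[OF fin] by blast
    then have "fv.dim (products w V n) \<le> card (monomials w (m * n) :: (nat \<Rightarrow> 'k) set)"
      using card_monomials(1)[OF fin] by (rule fv.dim_le_card)
    also have "\<dots> \<le> (2 * (m * n) + 1) * complexity w (2 * (m * n) + 1)"
      by (rule card_monomials(2)[OF fin])
    finally show ?thesis using growth_function_eq[OF generating_subspace_carrier[OF gen]] by simp
  qed
  then show ?thesis by (intro exI[of _ m]) (simp add: m_def)
qed

text \<open>Words of one length have disjoint sets of occurrences, so different pairs have disjoint supports:
  at a position where one of the matrices has the entry \<open>1\<close>, all others vanish.\<close>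

lemma cylinder_words_independent:
  assumes fin: "finite (range (\<lambda>i. window w i n))"
  defines "M \<equiv> (\<lambda>(u, s). cylinder w 0 u (int (length u) - int s) :: nat \<Rightarrow> 'k::field) `
     (range (\<lambda>i. window w i n) \<times> {..<n})"
  shows "fv.independent M" "card M = n * complexity w n"
proof -
  define J where "J = range (\<lambda>i. window w i n) \<times> {..<n}"
  define F where "F = (\<lambda>(u, s). cylinder w 0 u (int (length u) - int s) :: nat \<Rightarrow> 'k)"
  have M: "M = F ` J" unfolding M_def F_def J_def ..
  have witness: "\<exists>i j. entry (F p) i j = 1 \<and> (\<forall>q\<in>J. q \<noteq> p \<longrightarrow> entry (F q) i j = 0)" if p: "p \<in> J" for p
  proof -
    obtain i s where p_eq: "p = (window w i n, s)" using p unfolding J_def by auto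
    have "entry (F p) i (i + (int n - int s)) = 1" unfolding F_def p_eq by simp
    moreover have "entry (F q) i (i + (int n - int s)) = 0" if q: "q \<in> J" "q \<noteq> p" for q
    proof -
      obtain i' s' where q_eq: "q = (window w i' n, s')" using q unfolding J_def by auto
      show ?thesis using q(2) unfolding F_def p_eq q_eq by auto
    qed
    ultimately show ?thesis by blast
  qed
  have "inj_on F J"
  proof (rule inj_onI, rule ccontr)
    fix p q assume "p \<in> J" "q \<in> J" "F p = F q" "p \<noteq> q"
    then show False using witness[of p] by (metis one_neq_zero)
  qed
  then have "card M = card J" unfolding M by (rule card_image)
  then show "card M = n * complexity w n"
    unfolding J_def card_cartesian_product complexity_def by simp
  show "fv.independent M"
    unfolding fv.dependent_def
  proof
    assume "\<exists>a\<in>M. a \<in> fv.span (M - {a})"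
    then obtain p where p: "p \<in> J" "F p \<in> fv.span (M - {F p})" unfolding M by blast
    obtain i j where ij: "entry (F p) i j = 1" "\<And>q. q \<in> J \<Longrightarrow> q \<noteq> p \<Longrightarrow> entry (F q) i j = 0"
      using witness[OF p(1)] by blast
    have "fv.subspace {a :: nat \<Rightarrow> 'k. entry a i j = 0}" by (rule fv.subspaceI) simp_all
    moreover have "M - {F p} \<subseteq> {a. entry a i j = 0}" unfolding M using ij(2) by blast
    ultimately have "fv.span (M - {F p}) \<subseteq> {a. entry a i j = 0}" by (intro fv.span_minimal)
    then show False using p(2) ij(1) by auto
  qed
qed

text \<open>A product of indicators of letters, each followed by the shift, is the indicator of a word \<open>u\<close> on the
  diagonal \<open>length u\<close>.  Multiplying by the inverse shift \<open>s\<close> times moves it to the diagonal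
  \<open>length u - s\<close>, so \<open>n p(n)\<close> independent elements arise from at most \<open>2 n\<close> factors.  The factors that
  are used form a finite set and hence lie in a fixed power of the generating subspace.\<close>

lemma growth_lower:
  assumes fin: "\<And>n. finite (range (\<lambda>i. window w i n))"
    and gen: "generating_subspace scalars (word_algebra w :: ('k::field, nat \<Rightarrow> 'k) module) V"
  shows "\<exists>d\<ge>1. \<forall>n. n * complexity w n \<le> growth_function scalars (word_algebra w) V (d * n)"
proof -
  have V: "V \<subseteq> (\<Union>m. local_matrices w m)" by (rule generating_subspace_carrier[OF gen])
  have letters: "finite (range w)" by (rule finite_letters) (rule fin)
  define S :: "(nat \<Rightarrow> 'k) set" where "S = insert (cylinder w 0 [] (- 1)) ((\<lambda>x. cylinder w 0 [x] 1) ` range w)"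
  have "\<exists>d. \<forall>a\<in>S. a \<in> fv.span (products w V d)"
  proof -
    have "\<exists>d. a \<in> fv.span (products w V d)" if "a \<in> S" for a
      by (rule generating_subspace_exhausts[OF gen]) (use that cylinder_in_local in \<open>auto simp: S_def\<close>)
    then obtain d where d: "\<And>a. a \<in> S \<Longrightarrow> a \<in> fv.span (products w V (d a))" by metis
    have finS: "finite S" unfolding S_def using letters by simp
    have "a \<in> fv.span (products w V (Max (d ` S)))" if a: "a \<in> S" for a
    proof -
      have "d a \<le> Max (d ` S)" using finS a by simp
      then show ?thesis using d[OF a] fv.span_mono[OF products_mono] by blast
    qed
    then show ?thesis by blast
  qed
  then obtain d where d: "\<And>a. a \<in> S \<Longrightarrow> a \<in> fv.span (products w V d)" by blast
  have word: "cylinder w 0 u (int (length u)) \<in> fv.span (products w V (d * length u))" if "set u \<subseteq> range w" for u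
    using that
  proof (induction u)
    case Nil
    have "cylinder w 0 [] 0 \<in> products w V 0" unfolding products_def by (intro CollectI exI[of _ "[]"]) simp
    then show ?case by (simp add: fv.span_base)
  next
    case (Cons x u)
    have "cylinder w 0 [x] 1 \<in> fv.span (products w V d)" by (rule d) (use Cons.prems in \<open>simp add: S_def\<close>)
    then have "mat_mult (cylinder w 0 [x] 1) (cylinder w 0 u (int (length u))) \<in> fv.span (products w V (d + d * length u))"
      using Cons by (intro products_mat_mult[OF V]) simp_all
    then show ?case by (simp add: cylinder_Cons_shift algebra_simps)
  qed
  have shift: "cylinder w 0 u (int (length u) - int s) \<in> fv.span (products w V (d * (length u + s)))"
    if u: "set u \<subseteq> range w" for u s
  proof (induction s)
    case 0
    then show ?case using word[OF u] by simp
  next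
    case (Suc s)
    have "cylinder w 0 [] (- 1) \<in> fv.span (products w V d)" by (rule d) (simp add: S_def)
    then have "mat_mult (cylinder w 0 u (int (length u) - int s)) (cylinder w 0 [] (- 1))
        \<in> fv.span (products w V (d * (length u + s) + d))"
      using Suc by (intro products_mat_mult[OF V])
    then show ?case by (simp add: cylinder_shift_right algebra_simps)
  qed
  have "n * complexity w n \<le> growth_function scalars (word_algebra w) V ((2 * max 1 d) * n)" for n
  proof -
    define N where "N = (2 * max 1 d) * n"
    define M where "M = (\<lambda>(u, s). cylinder w 0 u (int (length u) - int s) :: nat \<Rightarrow> 'k) `
       (range (\<lambda>i. window w i n) \<times> {..<n})"
    have M: "fv.independent M" "card M = n * complexity w n"
      using cylinder_words_independent[OF fin, of n] unfolding M_def by blast+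
    have "M \<subseteq> fv.span (products w V N)"
    proof
      fix a assume "a \<in> M"
      then obtain i s where a: "a = cylinder w 0 (window w i n) (int n - int s)" "s < n"
        unfolding M_def by auto
      have "set (window w i n) \<subseteq> range w" by (auto simp: window_def)
      then have "a \<in> fv.span (products w V (d * (n + s)))" using shift[of "window w i n" s] a by simp
      moreover have "d * (n + s) \<le> max 1 d * (2 * n)" using a(2) by (intro mult_le_mono) auto
      then have "d * (n + s) \<le> N" unfolding N_def by (simp add: algebra_simps)
      ultimately show "a \<in> fv.span (products w V N)" using fv.span_mono[OF products_mono] by blast
    qed
    \<comment> \<open>A finite spanning set is needed since \<open>dim\<close> is \<open>0\<close> on spaces of infinite dimension.\<close>
    moreover obtain m where m: "V \<subseteq> local_matrices w m" using generating_subspace_level[OF gen] by blast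
    have "products w V N \<subseteq> fv.span (monomials w (m * N))"
      using products_subset_local[OF m] local_matrices_subset_span_monomials[OF fin] by blast
    ultimately have "card M \<le> fv.dim (products w V N)"
      using card_monomials(1)[OF fin] M(1) by (intro card_independent_le_dim)
    then show ?thesis unfolding N_def[symmetric] growth_function_eq[OF V] using M(2) by simp
  qed
  then show ?thesis by (intro exI[of _ "2 * max 1 d"]) simp
qed

text \<open>The generators are the shift, its inverse and the indicators of letters.  They give the indicators
  of all words of \<open>w\<close> by induction on the length: the indicator of \<open>x # u\<close> is that of \<open>x\<close> times the
  conjugate by the shift of that of \<open>u\<close>.\<close>

lemma word_algebra_finitely_generated:
  assumes fin: "\<And>n. finite (range (\<lambda>i. window w i n))"
  shows "finitely_generated_algebra scalars (word_algebra w :: ('k::field, nat \<Rightarrow> 'k) module)"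
proof -
  let ?A = "word_algebra w :: ('k, nat \<Rightarrow> 'k) module"
  have letters: "finite (range w)" by (rule finite_letters) (rule fin)
  define S :: "(nat \<Rightarrow> 'k) set" where
    "S = {cylinder w 0 [] 1, cylinder w 0 [] (- 1)} \<union> (\<lambda>x. cylinder w 0 [x] 0) ` range w"
  have finS: "finite S" unfolding S_def using letters by simp
  have S: "S \<subseteq> (\<Union>m. local_matrices w m)" unfolding S_def using cylinder_in_local by fastforce
  have span: "lin_span scalars ?A S = fv.span S" by (rule word_algebra_lin_span[OF S])
  have spanE: "fv.span S \<subseteq> (\<Union>m. local_matrices w m)" by (rule fv.span_minimal[OF S carrier_subspace])
  have "generating_subspace scalars ?A (fv.span S)"
    unfolding generating_subspace_def
  proof (intro conjI allI impI)
    show "submodule (fv.span S) scalars ?A"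
      unfolding word_algebra_submodule_iff using spanE by simp
    show "\<exists>T. finite T \<and> T \<subseteq> fv.span S \<and> lin_span scalars ?A T = fv.span S"
      using finS fv.span_superset span by blast
  next
    fix B assume B: "subring B ?A \<and> submodule B scalars ?A \<and> fv.span S \<subseteq> B"
    then interpret B: subring B ?A by blast
    have Bsub: "fv.subspace B" and BE: "B \<subseteq> (\<Union>m. local_matrices w m)"
      using B word_algebra_submodule_iff by blast+
    have SB: "S \<subseteq> B" using B fv.span_superset by blast
    have mult: "mat_mult a b \<in> B" if "a \<in> B" "b \<in> B" for a b
      using submonoid.m_closed[OF subring.axioms(2), of B ?A a b] B that by simp
    have one: "cylinder w 0 [] 0 \<in> B" using B.one_closed by simp
    have fwd: "cylinder w 0 [] (int n) \<in> B" for n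
    proof (induction n)
      case (Suc n)
      have "mat_mult (cylinder w 0 [] (int n)) (cylinder w 0 [] 1) \<in> B" using Suc SB by (intro mult) (auto simp: S_def)
      then show ?case by (simp add: cylinder_shift_right add.commute)
    qed (simp add: one)
    have bwd: "cylinder w 0 [] (- int n) \<in> B" for n
    proof (induction n)
      case (Suc n)
      have "mat_mult (cylinder w 0 [] (- int n)) (cylinder w 0 [] (- 1)) \<in> B" using Suc SB by (intro mult) (auto simp: S_def)
      moreover have "- int n + - 1 = - int (Suc n)" by simp
      ultimately show ?case unfolding cylinder_shift_right by (simp only:)
    qed (simp add: one)
    have T: "cylinder w 0 [] e \<in> B" for e by (cases e rule: int_cases2) (simp_all add: fwd bwd)
    have D: "cylinder w 0 u 0 \<in> B" if "set u \<subseteq> range w" for u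
      using that
    proof (induction u)
      case (Cons x u)
      have "mat_mult (cylinder w 0 [] 1) (mat_mult (cylinder w 0 u 0) (cylinder w 0 [] (- 1))) \<in> B"
        using Cons T by (intro mult) simp_all
      then have "cylinder w 1 u 0 \<in> B" by (simp add: cylinder_shift_left cylinder_shift_right)
      moreover have "cylinder w 0 [x] 0 \<in> B" using SB Cons.prems by (auto simp: S_def)
      ultimately show ?case using mult cylinder_Cons by metis
    qed (simp add: one)
    have "monomials w m \<subseteq> B" for m
    proof
      fix a assume "a \<in> (monomials w m :: (nat \<Rightarrow> 'k) set)"
      then obtain i d where a: "a = cylinder w (- int m) (window w i (2 * m + 1)) d"
        unfolding monomials_def by auto
      define u where "u = window w i (2 * m + 1)"
      have "set u \<subseteq> range w" by (auto simp: u_def window_def)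
      then have "mat_mult (cylinder w 0 [] (- int m)) (mat_mult (cylinder w 0 u 0) (cylinder w 0 [] (int m + d))) \<in> B"
        using T D by (intro mult) simp_all
      then show "a \<in> B" unfolding a u_def[symmetric] by (simp add: cylinder_shift_left cylinder_shift_right)
    qed
    then have "fv.span (monomials w m) \<subseteq> B" for m by (intro fv.span_minimal Bsub)
    then have "(\<Union>m. local_matrices w m) \<subseteq> B" using local_matrices_subset_span_monomials[OF fin] by blast
    then show "B = carrier ?A" using BE by auto
  qed
  then show ?thesis unfolding finitely_generated_algebra_def by blast
qed

section \<open>Simplicity\<close>

text \<open>If stretches of period \<open>q\<close> were arbitrarily long, then, by uniform recurrence, every window of length
  \<open>q + 1\<close> would occur in one of them.  So \<open>w\<close> would have period \<open>q\<close> and complexity at most \<open>q\<close>.\<close>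

lemma no_long_periods:
  assumes ur: "uniformly_recurrent w"
    and unbounded: "\<And>B. \<exists>n. B < complexity w n"
    and q: "0 < q"
  shows "\<exists>m. \<forall>i. \<not> agree w m i (i + q)"
proof (rule ccontr)
  assume "\<not> (\<exists>m. \<forall>i. \<not> agree w m i (i + q))"
  then have all: "\<exists>i. agree w m i (i + q)" for m by blast
  have periodic: "w (j + q) = w j" for j
  proof -
    obtain r where r: "\<And>i. \<exists>k\<le>r. window w (i + int k) (nat q + 1) = window w j (nat q + 1)"
      using ur unfolding uniformly_recurrent_def by blast
    obtain i where i: "agree w r i (i + q)" using all by blast
    obtain k where k: "k \<le> r" "window w (i + int k) (nat q + 1) = window w j (nat q + 1)" using r by blast
    have eq: "w (i + int k + int t) = w (j + int t)" if "t < nat q + 1" for t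
      using k(2) that unfolding window_eq_iff by blast
    have "w (i + int k) = w (i + q + int k)" using i k(1) unfolding agree_def by simp
    then show ?thesis using eq[of 0] eq[of "nat q"] q by (simp add: algebra_simps)
  qed
  have multiple: "w (j + int t * q) = w j" for j t
  proof (induction t)
    case (Suc t)
    have "w (j + int (Suc t) * q) = w ((j + int t * q) + q)" by (simp add: algebra_simps)
    then show ?case using Suc periodic by simp
  qed simp
  have mod_q: "w (j mod q + e) = w (j + e)" for j e
  proof (cases "0 \<le> j div q")
    case True
    then have "int (nat (j div q)) = j div q" by simp
    moreover have "j mod q + e + j div q * q = j + e" by (simp add: algebra_simps)
    ultimately show ?thesis using multiple[of "j mod q + e" "nat (j div q)"] by metis
  next
    case False
    then have "int (nat (- (j div q))) = - (j div q)" by simp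
    moreover have "j + e + - (j div q) * q = j mod q + e" by (simp add: algebra_simps flip: minus_div_mult_eq_mod)
    ultimately show ?thesis using multiple[of "j + e" "nat (- (j div q))"] by metis
  qed
  have "complexity w n \<le> nat q" for n
  proof -
    have "window w i n = window w (i mod q) n" for i
      unfolding window_eq_iff using mod_q by simp
    moreover have "i mod q \<in> {0..<q}" for i using q by simp
    ultimately have "range (\<lambda>i. window w i n) \<subseteq> (\<lambda>i. window w i n) ` {0..<q}" by blast
    then have "complexity w n \<le> card ((\<lambda>i. window w i n) ` {0..<q})"
      unfolding complexity_def by (intro card_mono) auto
    also have "\<dots> \<le> card {0..<q}" by (rule card_image_le) simp
    finally show ?thesis by simp
  qed
  then show False using unbounded[of "nat q"] by (meson not_le)
qed

lemma no_short_returns: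
  assumes ur: "uniformly_recurrent w"
    and unbounded: "\<And>B. \<exists>n. B < complexity w n"
  shows "\<exists>m. \<forall>i j. agree w m i j \<longrightarrow> \<bar>j - i\<bar> \<le> int r \<longrightarrow> i = j"
proof -
  have "\<exists>m. \<forall>q\<in>{1..int r}. \<forall>i. \<not> agree w m i (i + q)"
  proof -
    have "\<forall>q\<in>{1..int r}. \<exists>m. \<forall>i. \<not> agree w m i (i + q)"
      using no_long_periods[OF ur unbounded] by simp
    then obtain M where M: "\<And>q i. q \<in> {1..int r} \<Longrightarrow> \<not> agree w (M q) i (i + q)" by metis
    have "\<not> agree w (Max (M ` {1..int r})) i (i + q)" if q: "q \<in> {1..int r}" for q i
    proof -
      have "M q \<le> Max (M ` {1..int r})" using q by simp
      then show ?thesis using M[OF q] agree_le by blast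
    qed
    then show ?thesis by blast
  qed
  then obtain m where m: "\<And>q i. q \<in> {1..int r} \<Longrightarrow> \<not> agree w m i (i + q)" by blast
  have "i = j" if ag: "agree w m i j" and near: "\<bar>j - i\<bar> \<le> int r" for i j
  proof (rule ccontr)
    assume "i \<noteq> j"
    then consider "j - i \<in> {1..int r}" | "i - j \<in> {1..int r}" using near by force
    then show False
      using m[of "j - i" i] m[of "i - j" j] ag agree_sym[OF ag] by cases auto
  qed
  then show ?thesis by blast
qed

lemma entry_diff [simp]: "entry (a - b) i j = entry a i j - (entry b i j :: 'k::field)"
  by (simp add: entry_def)

text \<open>Indicators of arbitrary sets of rows.  Besides the occurrences of a single word, the proof of
  simplicity uses unions of translates of these.\<close>

definition diag :: "(int \<Rightarrow> bool) \<Rightarrow> nat \<Rightarrow> 'k::field" where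
  "diag P = of_entries (\<lambda>i j. if i = j \<and> P i then 1 else 0)"

lemma entry_diag [simp]: "entry (diag P) i j = (if i = j \<and> P i then 1 else 0)"
  by (simp add: diag_def)

lemma diag_local:
  assumes "\<And>i i'. agree w m i i' \<Longrightarrow> P i = P i'"
  shows "diag P \<in> local_matrices w m"
proof (rule local_matricesI)
  show "entry (diag P) i j = 0" if "int m < \<bar>j - i\<bar>" for i j using that by auto
  show "entry (diag P) i (i + d) = entry (diag P) i' (i' + d)" if "agree w m i i'" for i i' d
    using assms[OF that] by simp
qed

lemma entry_diag_mat_mult: "entry (mat_mult (diag P) b) i j = (if P i then entry b i j else 0)"
  by (subst entry_mat_mult[where S = "{i}"]) auto

lemma entry_mat_mult_diag:
  assumes "a \<in> local_matrices w m"
  shows "entry (mat_mult a (diag P)) i j = (if P j then entry a i j else 0)"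
proof -
  have "entry (mat_mult a (diag P)) i j = (\<Sum>k\<in>insert j {i - int m..i + int m}. entry a i k * entry (diag P) k j)"
    by (rule entry_mat_mult) (use local_matrices_row[OF assms, of _ i] in auto)
  also have "\<dots> = (\<Sum>k\<in>{j}. entry a i k * entry (diag P) k j)"
    by (rule sum.mono_neutral_right) auto
  finally show ?thesis by simp
qed

text \<open>In a nonzero ideal there is an element \<open>b\<close> with a nonzero entry on the main diagonal, obtained by a
  shift.  Let \<open>P\<close> be the set of returns of a window so long that two returns within the bandwidth
  of \<open>b\<close> coincide.  Then \<open>diag P\<close> times \<open>b\<close> times \<open>diag P\<close> is a nonzero multiple of \<open>diag P\<close>.  Conjugates
  by powers of the shift give the translates of \<open>P\<close>, and finitely many of them cover the integers.\<close>

lemma word_algebra_simple: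
  assumes ur: "uniformly_recurrent w"
    and unbounded: "\<And>B. \<exists>n. B < complexity w n"
  shows "simple_algebra (word_algebra w :: ('k::field, nat \<Rightarrow> 'k) module)"
proof -
  let ?A = "word_algebra w :: ('k, nat \<Rightarrow> 'k) module"
  have "carrier ?A \<noteq> {\<zero>\<^bsub>?A\<^esub>}"
  proof
    assume "carrier ?A = {\<zero>\<^bsub>?A\<^esub>}"
    then have "cylinder w 0 [] 0 = (0 :: nat \<Rightarrow> 'k)" using cylinder_in_local[of w 0 "[]" 0] by auto
    then have "entry (cylinder w 0 [] 0) 0 0 = (0 :: 'k)" by simp
    then show False by simp
  qed
  moreover have "I = carrier ?A" if I: "ideal I ?A" and nonzero: "I \<noteq> {\<zero>\<^bsub>?A\<^esub>}" for I
  proof -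
    interpret I: ideal I ?A by (rule I)
    have IE: "I \<subseteq> (\<Union>m. local_matrices w m)" using I.a_subset by simp
    have left: "mat_mult c x \<in> I" if "x \<in> I" "c \<in> local_matrices w m" for c x m
      using I.I_l_closed[of x c] that by auto
    have right: "mat_mult x c \<in> I" if "x \<in> I" "c \<in> local_matrices w m" for c x m
      using I.I_r_closed[of x c] that by auto
    have add: "x + y \<in> I" if "x \<in> I" "y \<in> I" for x y
      using additive_subgroup.a_closed[OF I.is_additive_subgroup that] by simp
    have zero: "0 \<in> I" using additive_subgroup.zero_closed[OF I.is_additive_subgroup] by simp
    have scale_closed: "scale c x \<in> I" if x: "x \<in> I" for c x
    proof -
      have one: "(cylinder w 0 [] 0 :: nat \<Rightarrow> 'k) \<in> local_matrices w 0" by (rule cylinder_local) simp_all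
      have "mat_mult (scale c (cylinder w 0 [] 0)) x \<in> I"
        by (rule left[OF x]) (rule fv.subspace_scale[OF local_matrices_subspace one])
      then show ?thesis unfolding mat_mult_scale_left[OF one] mat_mult_one_left .
    qed
    have diff: "x - y \<in> I" if "x \<in> I" "y \<in> I" for x y
      using add[OF that(1) scale_closed[OF that(2), of "- 1"]] by simp
    obtain a where a: "a \<in> I" "a \<noteq> 0" using nonzero zero by auto
    obtain i0 j0 where ij: "entry a i0 j0 \<noteq> 0" using a(2) entry_eqI[of a 0] by auto
    obtain m0 where m0: "a \<in> local_matrices w m0" using a(1) IE by blast
    define b where "b = mat_mult a (cylinder w 0 [] (i0 - j0))"
    obtain m1 where m1: "(cylinder w 0 [] (i0 - j0) :: nat \<Rightarrow> 'k) \<in> local_matrices w m1" using cylinder_in_local by blast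
    have b: "b \<in> I" unfolding b_def by (rule right[OF a(1) m1])
    have b00: "entry b i0 i0 \<noteq> 0" unfolding b_def entry_mat_mult_shift[OF m0] using ij by simp
    obtain m where bm: "b \<in> local_matrices w m" using b IE by blast
    obtain m2 where m2: "\<And>i j. agree w m2 i j \<Longrightarrow> \<bar>j - i\<bar> \<le> int m \<Longrightarrow> i = j"
      using no_short_returns[OF ur unbounded] by blast
    define l where "l = max m m2"
    define P where "P = agree w l i0"
    have P_unique: "i = j" if "P i" "P j" "\<bar>j - i\<bar> \<le> int m" for i j
    proof -
      have "agree w l i j" using that(1,2) agree_sym agree_trans unfolding P_def by metis
      then have "agree w m2 i j" by (rule agree_le) (simp add: l_def)
      then show ?thesis using m2 that(3) by blast
    qed
    have PE: "diag P \<in> local_matrices w l"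
    proof (rule diag_local)
      show "P i = P i'" if "agree w l i i'" for i i'
        using that agree_trans agree_sym unfolding P_def by metis
    qed
    have corner: "mat_mult (mat_mult (diag P) b) (diag P) = scale (entry b i0 i0) (diag P)"
    proof (rule entry_eqI)
      fix i j
      have "entry b i j = (if i = j then entry b i0 i0 else 0)" if "P i" "P j"
      proof (cases "i = j")
        case True
        have "agree w m i0 i" using that(1) unfolding P_def by (rule agree_le) (simp add: l_def)
        then show ?thesis using local_matrices_local[OF bm, of i0 i 0] True by simp
      next
        case False
        then have "int m < \<bar>j - i\<bar>" using P_unique that by (meson not_le)
        then show ?thesis using local_matrices_band[OF bm] False by simp
      qed
      then show "entry (mat_mult (mat_mult (diag P) b) (diag P)) i j = entry (scale (entry b i0 i0) (diag P)) i j"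
        using entry_mat_mult_diag[OF local_matrices_mat_mult[OF PE bm], of P i j] by (auto simp: entry_diag_mat_mult)
    qed
    have "mat_mult (mat_mult (diag P) b) (diag P) \<in> I" by (rule right[OF left[OF b PE] PE])
    then have "scale (inverse (entry b i0 i0)) (scale (entry b i0 i0) (diag P)) \<in> I"
      unfolding corner by (rule scale_closed)
    then have P: "diag P \<in> I" using b00 by simp
    have shifted: "diag (\<lambda>i. P (i + k)) \<in> I" for k
    proof -
      obtain n1 n2 where T: "(cylinder w 0 [] k :: nat \<Rightarrow> 'k) \<in> local_matrices w n1" "(cylinder w 0 [] (- k) :: nat \<Rightarrow> 'k) \<in> local_matrices w n2"
        using cylinder_in_local by metis
      have "mat_mult (mat_mult (cylinder w 0 [] k) (diag P)) (cylinder w 0 [] (- k)) = (diag (\<lambda>i. P (i + k)) :: nat \<Rightarrow> 'k)"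
        by (rule entry_eqI) (simp add: entry_mat_mult_shift[OF local_matrices_mat_mult[OF T(1) PE]] entry_cylinder_mat_mult)
      then show ?thesis using right[OF left[OF P T(1)] T(2)] by simp
    qed
    have cover: "diag (\<lambda>i. \<exists>k<n. P (i + int k)) \<in> I" for n
    proof (induction n)
      case 0
      have "diag (\<lambda>i. \<exists>k<0::nat. P (i + int k)) = (0 :: nat \<Rightarrow> 'k)" by (rule entry_eqI) simp
      then show ?case using zero by (simp only:)
    next
      case (Suc n)
      let ?S = "diag (\<lambda>i. \<exists>k<n. P (i + int k)) :: nat \<Rightarrow> 'k" and ?Q = "diag (\<lambda>i. P (i + int n)) :: nat \<Rightarrow> 'k"
      obtain n1 where S: "?S \<in> local_matrices w n1" using Suc IE by blast
      \<comment> \<open>The indicator of a union of two sets is \<open>S + (Q - S Q)\<close>, which stays in the ideal.\<close>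
      have "diag (\<lambda>i. \<exists>k<Suc n. P (i + int k)) = ?S + (?Q - mat_mult ?S ?Q)"
        by (rule entry_eqI) (auto simp: entry_diag_mat_mult less_Suc_eq)
      then show ?case using add[OF Suc diff[OF shifted left[OF shifted S]]] by (simp only:)
    qed
    obtain r where r: "\<And>j. \<exists>k\<le>r. window w (j + int k) (2 * l + 1) = window w (i0 - int l) (2 * l + 1)"
      using ur unfolding uniformly_recurrent_def by blast
    have "\<exists>k<Suc r. P (i + int k)" for i
    proof -
      obtain k where "k \<le> r" "window w (i - int l + int k) (2 * l + 1) = window w (i0 - int l) (2 * l + 1)"
        using r by blast
      then have "agree w l i0 (i + int k)" unfolding agree_window by (simp add: algebra_simps)
      then show ?thesis using \<open>k \<le> r\<close> unfolding P_def by (intro exI[of _ k]) simp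
    qed
    then have "diag (\<lambda>i. \<exists>k<Suc r. P (i + int k)) = (cylinder w 0 [] 0 :: nat \<Rightarrow> 'k)" by (intro entry_eqI) auto
    then have one: "cylinder w 0 [] 0 \<in> I" using cover[of "Suc r"] by simp
    have "x \<in> I" if "x \<in> local_matrices w n" for x n
      using right[OF one that] by (simp add: mat_mult_one_left)
    then show ?thesis using IE by auto
  qed
  ultimately show ?thesis unfolding simple_algebra_def by blast
qed

section \<open>Simple algebras of prescribed growth\<close>

theorem corollary5p5:
  fixes f :: "nat \<Rightarrow> nat"
  defines "K \<equiv> (ring_of_type_algebra :: 'k::field ring)"
  assumes "mono f"
    and "submultiplicative f"
    and "filterlim f at_top sequentially"
  shows "\<exists>A :: ('k, nat \<Rightarrow> 'k) module.
           assoc_algebra K A \<and> finitely_generated_algebra K A \<and> simple_algebra A \<and>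
           (\<forall>V. generating_subspace K A V \<longrightarrow>
              growth_le (\<lambda>n. n * f n) (growth_function K A V) \<and>
              growth_le (growth_function K A V) (\<lambda>n. n\<^sup>2 * f n))"
proof -
  have sub: "f (m + n) \<le> f m * f n" for m n
    using assms(3) unfolding submultiplicative_def by blast
  have unbounded: "\<exists>n\<ge>N. B \<le> f n" for B N
  proof -
    have "eventually (\<lambda>n. B \<le> f n) sequentially"
      using assms(4) unfolding filterlim_at_top by blast
    then obtain M where "\<And>n. M \<le> n \<Longrightarrow> B \<le> f n" unfolding eventually_sequentially by blast
    then show ?thesis by (intro exI[of _ "max M N"]) simp
  qed
  have pos: "1 \<le> f n" for n
  proof (rule ccontr)
    assume "\<not> 1 \<le> f n"
    then have zero: "f n = 0" by simp
    obtain m where m: "n \<le> m" "1 \<le> f m" using unbounded by blast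
    have "f m \<le> f n * f (m - n)" using sub[of n "m - n"] m(1) by simp
    then show False using zero m(2) by simp
  qed
  obtain w :: "int \<Rightarrow> nat" where fin: "\<And>n. finite (range (\<lambda>i. window w i n))"
    and ur: "uniformly_recurrent w"
    and upper: "\<And>n. 1 \<le> n \<Longrightarrow> complexity w n \<le> 144 * n * f (4 * n)"
    and lower: "\<And>n. 1 \<le> n \<Longrightarrow> f n \<le> complexity w (4 * n)"
    by (rule recurrent_word_of_complexity[OF assms(2) sub pos]) (rule that; assumption)
  have complex: "\<exists>n. B < complexity w n" for B
  proof -
    obtain n where "1 \<le> n" "Suc B \<le> f n" using unbounded by blast
    then have "B < complexity w (4 * n)" using lower[of n] by simp
    then show ?thesis by blast
  qed
  define A where "A = (word_algebra w :: ('k, nat \<Rightarrow> 'k) module)"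
  have "growth_le (\<lambda>n. n * f n) (growth_function K A V) \<and>
        growth_le (growth_function K A V) (\<lambda>n. n\<^sup>2 * f n)" if gen: "generating_subspace K A V" for V
  proof
    obtain d where d: "1 \<le> d" "\<And>n. n * complexity w n \<le> growth_function K A V (d * n)"
      using growth_lower[OF fin gen[unfolded K_def A_def]] unfolding K_def A_def by blast
    have "n * f n \<le> growth_function K A V ((4 * d) * n)" if "1 \<le> n" for n
    proof -
      have "n * f n \<le> (4 * n) * complexity w (4 * n)" using lower[OF that] by (intro mult_le_mono) auto
      also have "\<dots> \<le> growth_function K A V (d * (4 * n))" by (rule d)
      also have "d * (4 * n) = (4 * d) * n" by simp
      finally show ?thesis .
    qed
    then have "\<forall>n\<ge>1. real (n * f n) \<le> 1 * real (growth_function K A V ((4 * d) * n))"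
      by (simp only: mult_1 of_nat_le_iff) blast
    then show "growth_le (\<lambda>n. n * f n) (growth_function K A V)"
      unfolding growth_le_def using d(1) by (intro exI[of _ 1] conjI exI[of _ "4 * d"]) auto
  next
    obtain m where m: "1 \<le> m" "\<And>n. growth_function K A V n
        \<le> (2 * (m * n) + 1) * complexity w (2 * (m * n) + 1)"
      using growth_upper[OF fin gen[unfolded K_def A_def]] unfolding K_def A_def by blast
    \<comment> \<open>The estimate is absorbed at \<open>N = 3 m n \<ge> 2 m n + 1\<close>: the bound \<open>144 N\<^sup>2 f (4 N)\<close> equals
      \<open>9 (4 N)\<^sup>2 f (4 N)\<close>, and \<open>4 N = 12 m n\<close>.\<close>
    have "growth_function K A V n \<le> 9 * (((12 * m) * n)\<^sup>2 * f ((12 * m) * n))" if n: "1 \<le> n" for n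
    proof -
      define N where "N = 3 * (m * n)"
      have "1 \<le> m * n" using m(1) n by simp
      then have N: "1 \<le> N" "2 * (m * n) + 1 \<le> N" unfolding N_def by linarith+
      have "growth_function K A V n \<le> (2 * (m * n) + 1) * complexity w (2 * (m * n) + 1)" by (rule m)
      also have "\<dots> \<le> N * complexity w N"
        using N(2) by (intro mult_le_mono complexity_mono fin)
      also have "\<dots> \<le> N * (144 * N * f (4 * N))" using upper[OF N(1)] by simp
      also have "\<dots> = 9 * ((4 * N)\<^sup>2 * f (4 * N))" by (simp add: power2_eq_square)
      also have "4 * N = (12 * m) * n" by (simp add: N_def)
      finally show ?thesis .
    qed
    then have "\<forall>n\<ge>1. real (growth_function K A V n) \<le> real (9 * (((12 * m) * n)\<^sup>2 * f ((12 * m) * n)))"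
      by (simp only: of_nat_le_iff) blast
    then have "\<forall>n\<ge>1. real (growth_function K A V n) \<le> 9 * real (((12 * m) * n)\<^sup>2 * f ((12 * m) * n))"
      by (simp only: of_nat_mult of_nat_numeral)
    then show "growth_le (growth_function K A V) (\<lambda>n. n\<^sup>2 * f n)"
      unfolding growth_le_def using m(1) by (intro exI[of _ 9] conjI exI[of _ "12 * m"]) auto
  qed
  moreover have "assoc_algebra K A" unfolding K_def A_def by (rule word_algebra_assoc_algebra)
  moreover have "finitely_generated_algebra K A"
    unfolding K_def A_def by (rule word_algebra_finitely_generated[OF fin])
  moreover have "simple_algebra A" unfolding A_def by (rule word_algebra_simple[OF ur complex])
  ultimately show ?thesis by blast
qed

end
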